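(* A compact space is Valdivia compact if and only if it has a commutative r-skeleton.
   Context: All spaces are Hausdorff and "map" means continuous map. For a set $T$, $\Sigma(T)=\{x\in[0,1]^T: \{\alpha\in T: x(\alpha)\neq 0\}\text{ is countable}\}$. A compact space $X$ is Valdivia compact if for some set $T$ there is an embedding $h\colon X\to[0,1]^T$ with $h[X]=\operatorname{cl}(\Sigma(T)\cap h[X])$, the closure being taken in $[0,1]^T$. Inverse systems $\mathbb S=\langle X_s;r_s^t;\Sigma\rangle$ consist of compact spaces $X_s$ indexed by a directed poset $\Sigma$, with surjective bonding maps $r_s^t\colon X_t\to X_s$ ($s\le t$). $\mathbb S$ is $\sigma$-complete if every countable directed $T\subseteq\Sigma$ has a least upper bound $t=\sup T$ in $\Sigma$ and $X_t$, together with the maps $r^t_s$ ($s\in T$), is the limit of the restriction of $\mathbb S$ to $T$. A right inverse of $\mathbb S$ is a collection $\{i_s^t: s\le t,\ s,t\in\Sigma\}$ of embeddings $i_s^t\colon X_s\to X_t$ with $i_s^s=\mathrm{id}_{X_s}$, $r_s^t i_s^t=\mathrm{id}_{X_s}$ for $s\le t$, and $i_t^u i_s^t=i_s^u$ for $s\le t\le u$. If $X=\varprojlim\mathbb S$ with projections $r_s\colon X\to X_s$, a right inverse of $\mathbb S$ determines unique embeddings $i_s\colon X_s\to X$ with $r_s i_s=\mathrm{id}_{X_s}$ and $i_t i_s^t=i_s$ for all $s\le t$. An r-skeleton in a space $X$ is a pair $\langle\mathbb S,\mathbb I\rangle$, where $\mathbb S=\langle X_s;r_s^t;\Sigma\rangle$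 is a $\sigma$-complete inverse system of second countable spaces with $X=\varprojlim\mathbb S$, and $\mathbb I=\{i_s^t\}$ is a right inverse of $\mathbb S$. It is commutative if $(i_s r_s)(i_t r_t)=(i_t r_t)(i_s r_s)$ for every $s,t\in\Sigma$. *)

theory Defs
  imports "HOL-Analysis.Analysis"
begin

section \<open>Valdivia compact spaces\<close>

definition unit_cube :: "'k set \<Rightarrow> ('k \<Rightarrow> real) topology" where
  "unit_cube T = product_topology (\<lambda>_. top_of_set {0..1}) T"

definition Sigma_product :: "'k set \<Rightarrow> ('k \<Rightarrow> real) set" where
  "Sigma_product T = {x \<in> topspace (unit_cube T). countable {\<alpha> \<in> T. x \<alpha> \<noteq> 0}}"

definition valdivia_embedding :: "'a topology \<Rightarrow> 'k set \<Rightarrow> ('a \<Rightarrow> 'k \<Rightarrow> real) \<Rightarrow> bool" where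
  "valdivia_embedding X T h \<longleftrightarrow>
     embedding_map X (unit_cube T) h \<and>
     h ` topspace X = unit_cube T closure_of (Sigma_product T \<inter> h ` topspace X)"

text \<open>
  A definition cannot quantify over the type of the exponent \<open>T\<close>, so \<open>T\<close> is taken to be a set of
  functions on \<open>X\<close>. This loses nothing: in an embedding into \<open>[0,1]\<^sup>T\<close> one may keep a single index
  for each coordinate function on \<open>X\<close>, and deleting repeated coordinates preserves injectivity
  and only enlarges the preimage of the Sigma-product.
\<close>
definition valdivia_compact :: "'a topology \<Rightarrow> bool" where
  "valdivia_compact X \<longleftrightarrow>
     compact_space X \<and> Hausdorff_space X \<and>
     (\<exists>(T :: ('a \<Rightarrow> real) set) h. valdivia_embedding X T h)"


section \<open>Inverse systems\<close>

text \<open>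
  Index sets are posets \<open>\<langle>I, le\<rangle>\<close> in the sense of \<^const>\<open>partial_order_on\<close>; \<open>(s, t) \<in> le\<close> means
  \<open>s \<le> t\<close>. Directed sets are nonempty. The bonding map from \<open>Y t\<close> to \<open>Y s\<close> is \<open>r s t\<close>,
  and the right inverse from \<open>Y s\<close> to \<open>Y t\<close> is \<open>i s t\<close>.
\<close>

definition directed_set :: "'i rel \<Rightarrow> 'i set \<Rightarrow> bool" where
  "directed_set le D \<longleftrightarrow>
     D \<noteq> {} \<and> (\<forall>s\<in>D. \<forall>t\<in>D. \<exists>u\<in>D. (s, u) \<in> le \<and> (t, u) \<in> le)"

definition is_supremum :: "'i set \<Rightarrow> 'i rel \<Rightarrow> 'i set \<Rightarrow> 'i \<Rightarrow> bool" where
  "is_supremum I le D t \<longleftrightarrow>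
     t \<in> I \<and> (\<forall>s\<in>D. (s, t) \<in> le) \<and>
     (\<forall>u\<in>I. (\<forall>s\<in>D. (s, u) \<in> le) \<longrightarrow> (t, u) \<in> le)"

definition inverse_system ::
  "'i set \<Rightarrow> 'i rel \<Rightarrow> ('i \<Rightarrow> 'b topology) \<Rightarrow> ('i \<Rightarrow> 'i \<Rightarrow> 'b \<Rightarrow> 'b) \<Rightarrow> bool" where
  "inverse_system I le Y r \<longleftrightarrow>
     partial_order_on I le \<and> directed_set le I \<and>
     (\<forall>s\<in>I. compact_space (Y s) \<and> Hausdorff_space (Y s)) \<and>
     (\<forall>s t. (s, t) \<in> le \<longrightarrow>
        continuous_map (Y t) (Y s) (r s t) \<and> r s t ` topspace (Y t) = topspace (Y s)) \<and>
     (\<forall>s\<in>I. \<forall>x\<in>topspace (Y s). r s s x = x) \<and>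
     (\<forall>s t u. (s, t) \<in> le \<and> (t, u) \<in> le \<longrightarrow>
        (\<forall>x\<in>topspace (Y u). r s t (r t u x) = r s u x))"

definition inverse_limit ::
  "'i set \<Rightarrow> 'i rel \<Rightarrow> ('i \<Rightarrow> 'b topology) \<Rightarrow> ('i \<Rightarrow> 'i \<Rightarrow> 'b \<Rightarrow> 'b) \<Rightarrow> ('i \<Rightarrow> 'b) topology" where
  "inverse_limit I le Y r =
     subtopology (product_topology Y I)
       {x. \<forall>s\<in>I. \<forall>t\<in>I. (s, t) \<in> le \<longrightarrow> r s t (x t) = x s}"

text \<open>\<open>X\<close> together with projections \<open>p s\<close> is the limit of the system over the index set \<open>I\<close>.\<close>
definition is_inverse_limit ::
  "'a topology \<Rightarrow> ('i \<Rightarrow> 'a \<Rightarrow> 'b) \<Rightarrow>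
   'i set \<Rightarrow> 'i rel \<Rightarrow> ('i \<Rightarrow> 'b topology) \<Rightarrow> ('i \<Rightarrow> 'i \<Rightarrow> 'b \<Rightarrow> 'b) \<Rightarrow> bool" where
  "is_inverse_limit X p I le Y r \<longleftrightarrow>
     homeomorphic_map X (inverse_limit I le Y r) (\<lambda>x. \<lambda>s\<in>I. p s x)"

definition sigma_complete ::
  "'i set \<Rightarrow> 'i rel \<Rightarrow> ('i \<Rightarrow> 'b topology) \<Rightarrow> ('i \<Rightarrow> 'i \<Rightarrow> 'b \<Rightarrow> 'b) \<Rightarrow> bool" where
  "sigma_complete I le Y r \<longleftrightarrow>
     (\<forall>D. D \<subseteq> I \<and> countable D \<and> directed_set le D \<longrightarrow>
        (\<exists>t. is_supremum I le D t \<and> is_inverse_limit (Y t) (\<lambda>s. r s t) D le Y r))"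

definition right_inverse ::
  "'i set \<Rightarrow> 'i rel \<Rightarrow> ('i \<Rightarrow> 'b topology) \<Rightarrow> ('i \<Rightarrow> 'i \<Rightarrow> 'b \<Rightarrow> 'b) \<Rightarrow> ('i \<Rightarrow> 'i \<Rightarrow> 'b \<Rightarrow> 'b) \<Rightarrow> bool" where
  "right_inverse I le Y r i \<longleftrightarrow>
     (\<forall>s t. (s, t) \<in> le \<longrightarrow>
        embedding_map (Y s) (Y t) (i s t) \<and> (\<forall>x\<in>topspace (Y s). r s t (i s t x) = x)) \<and>
     (\<forall>s\<in>I. \<forall>x\<in>topspace (Y s). i s s x = x) \<and>
     (\<forall>s t u. (s, t) \<in> le \<and> (t, u) \<in> le \<longrightarrow>
        (\<forall>x\<in>topspace (Y s). i t u (i s t x) = i s u x))"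


section \<open>Commutative r-skeletons\<close>

definition r_skeleton ::
  "'a topology \<Rightarrow> 'i set \<Rightarrow> 'i rel \<Rightarrow> ('i \<Rightarrow> 'b topology) \<Rightarrow> ('i \<Rightarrow> 'i \<Rightarrow> 'b \<Rightarrow> 'b) \<Rightarrow>
   ('i \<Rightarrow> 'a \<Rightarrow> 'b) \<Rightarrow> ('i \<Rightarrow> 'i \<Rightarrow> 'b \<Rightarrow> 'b) \<Rightarrow> bool" where
  "r_skeleton X I le Y r p i \<longleftrightarrow>
     inverse_system I le Y r \<and> sigma_complete I le Y r \<and>
     (\<forall>s\<in>I. second_countable (Y s)) \<and>
     is_inverse_limit X p I le Y r \<and>
     right_inverse I le Y r i"

definition limit_embeddings ::
  "'a topology \<Rightarrow> 'i set \<Rightarrow> 'i rel \<Rightarrow> ('i \<Rightarrow> 'b topology) \<Rightarrow>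
   ('i \<Rightarrow> 'a \<Rightarrow> 'b) \<Rightarrow> ('i \<Rightarrow> 'i \<Rightarrow> 'b \<Rightarrow> 'b) \<Rightarrow> ('i \<Rightarrow> 'b \<Rightarrow> 'a) \<Rightarrow> bool" where
  "limit_embeddings X I le Y p i e \<longleftrightarrow>
     (\<forall>s\<in>I. embedding_map (Y s) X (e s) \<and> (\<forall>x\<in>topspace (Y s). p s (e s x) = x)) \<and>
     (\<forall>s t. (s, t) \<in> le \<longrightarrow> (\<forall>x\<in>topspace (Y s). e t (i s t x) = e s x))"

text \<open>
  The embeddings \<open>e s\<close> of \<open>Y s\<close> into the limit exist and are unique on \<open>topspace (Y s)\<close>, so the
  existential quantifier merely names them.
\<close>
definition commutative_r_skeleton ::
  "'a topology \<Rightarrow> 'i set \<Rightarrow> 'i rel \<Rightarrow> ('i \<Rightarrow> 'b topology) \<Rightarrow> ('i \<Rightarrow> 'i \<Rightarrow> 'b \<Rightarrow> 'b) \<Rightarrow>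
   ('i \<Rightarrow> 'a \<Rightarrow> 'b) \<Rightarrow> ('i \<Rightarrow> 'i \<Rightarrow> 'b \<Rightarrow> 'b) \<Rightarrow> bool" where
  "commutative_r_skeleton X I le Y r p i \<longleftrightarrow>
     r_skeleton X I le Y r p i \<and>
     (\<exists>e. limit_embeddings X I le Y p i e \<and>
        (\<forall>s\<in>I. \<forall>t\<in>I. \<forall>x\<in>topspace X.
           e s (p s (e t (p t x))) = e t (p t (e s (p s x)))))"

text \<open>
  As for \<^const>\<open>valdivia_compact\<close>, the types of the witnesses must be fixed. The spaces \<open>Y s\<close> embed
  into \<open>X\<close>, so they may live on the type of \<open>X\<close>; the index type is large enough for the countable
  subsets of an exponent of a Valdivia embedding.
\<close>
definition has_commutative_r_skeleton :: "'a topology \<Rightarrow> bool" where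
  "has_commutative_r_skeleton X \<longleftrightarrow>
     (\<exists>(I :: ('a \<Rightarrow> real) set set) le (Y :: _ \<Rightarrow> 'a topology) r p i.
        commutative_r_skeleton X I le Y r p i)"

end

(* From an embedding into [0,1]^T with dense Sigma-part, the skeleton consists of the retractions
   setting to zero all coordinates outside a countable S, for those S that keep the space invariant;
   a closing-off argument based on separability shows that these S are cofinal.

   Conversely, write R s for the retraction of X onto the copy of Y s. Commutativity allows one to
   pass to the limit of R s along any directed set A of indices: t being fixed, second countability
   of R t X makes a countable subset of A decide the limit on R t X. By induction on the cardinality
   of A one finds [0,1]-valued functions that separate exactly the points separated by A and of which
   only countably many are nonzero at each point of each R s X. For uncountable A, one writes A as an
   increasing union of smaller directed sets M a; with L a the union of the M b, b < a, each function
   f given for M a is replaced by the positive and negative parts of f - f o (limit of R along L a). *)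
theory Submission
  imports Defs
begin

section \<open>Compactness and second countability\<close>

text \<open>Taken together, the functions found for all \<open>M a\<close> do separate what
  \<open>A\<close> separates, but uncountably many of them may be nonzero at one point, since the
  sets \<open>M a\<close> overlap. Subtracting the value at the projection along \<open>L a\<close>
  removes what earlier stages already record: the difference vanishes at \<open>x\<close> unless the
  projection of \<open>x\<close> changes between \<open>L a\<close> and \<open>M a\<close>. Nothing
  is lost, because well-founded recursion recovers \<open>f x\<close> from the differences:
  agreement along \<open>L a\<close> fixes the subtracted value. Using the union \<open>L a\<close>
  instead of a predecessor treats successor and limit stages alike. Commutativity enters twice.
  Compactness yields a point of the limit set with the required values of \<open>R s\<close>, but
  its uniqueness rests on exchanging \<open>R s\<close> with an arbitrary \<open>R t\<close>. The
  same exchange keeps projections inside the image of each \<open>R t\<close>, the second countable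
  space in which the changes are counted. Both directions pass through families of functions on
  \<open>X\<close> itself; with the functions as their own indices, the types of exponents and index
  sets become immaterial.\<close>

text \<open>Directedness places a member inside every finite intersection, so the finite
  intersection property reduces to nonemptiness of single members. Points with compatible prescribed
  data arise from this in both directions.\<close>

lemma compact_space_directed_Inter:
  assumes "compact_space X" and "A \<noteq> {}"
    and closed: "\<And>s. s \<in> A \<Longrightarrow> closedin X (C s)"
    and nonempty: "\<And>s. s \<in> A \<Longrightarrow> C s \<noteq> {}"
    and directed: "\<And>s t. s \<in> A \<Longrightarrow> t \<in> A \<Longrightarrow> \<exists>u\<in>A. C u \<subseteq> C s \<inter> C t"
  shows "\<exists>x\<in>topspace X. \<forall>s\<in>A. x \<in> C s"
proof -
  have fin: "\<exists>u\<in>A. C u \<subseteq> \<Inter>(C ` T)" if "finite T" "T \<subseteq> A" for T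
    using that
  proof (induction T)
    case empty
    then show ?case using \<open>A \<noteq> {}\<close> by auto
  next
    case (insert s T)
    then obtain u where u: "u \<in> A" "C u \<subseteq> \<Inter>(C ` T)" by auto
    obtain v where "v \<in> A" "C v \<subseteq> C s \<inter> C u"
      using directed[of s u] insert.prems u by auto
    with u show ?case by auto
  qed
  have "\<Inter>(C ` A) \<noteq> {}"
  proof (rule compact_space_fip[THEN iffD1, rule_format, OF \<open>compact_space X\<close>], intro conjI allI impI ballI)
    fix D assume "D \<in> C ` A" then show "closedin X D" using closed by auto
  next
    fix \<F> assume "finite \<F> \<and> \<F> \<subseteq> C ` A"
    then obtain T where "T \<subseteq> A" "finite T" "\<F> = C ` T"
      by (meson finite_subset_image)
    moreover from this obtain u where "u \<in> A" "C u \<subseteq> \<Inter>(C ` T)"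
      using fin by meson
    ultimately show "\<Inter>\<F> \<noteq> {}" using nonempty[of u] by auto
  qed
  then show ?thesis
    using \<open>A \<noteq> {}\<close> closed closedin_subset by (metis INT_E all_not_in_conv subset_eq)
qed

text \<open>\<open>\<rho>\<close> is \<open>q\<close> followed by the inverse of the closed
  injection \<open>g\<close>, so its preimage of \<open>C\<close> is the preimage under
  \<open>q\<close> of the closed image of \<open>C\<close> under \<open>g\<close>. This makes
  retractions continuous that are defined by pointwise choice.\<close>

lemma continuous_map_lift_injective:
  assumes "compact_space Z" "Hausdorff_space P"
    and g: "continuous_map Z P g" "inj_on g (topspace Z)"
    and q: "continuous_map X P q"
    and lift: "\<And>x. x \<in> topspace X \<Longrightarrow> \<rho> x \<in> topspace Z \<and> g (\<rho> x) = q x"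
  shows "continuous_map X Z \<rho>"
  unfolding continuous_map_closedin
proof (intro conjI allI impI)
  show "\<rho> \<in> topspace X \<rightarrow> topspace Z" using lift by auto
  fix C assume C: "closedin Z C"
  have "closedin P (g ` C)"
    using continuous_imp_closed_map[OF g(1) assms(1,2)] C by (simp add: closed_map_def)
  then have "closedin X {x \<in> topspace X. q x \<in> g ` C}"
    by (rule closedin_continuous_map_preimage[OF q])
  moreover have "q x \<in> g ` C \<longleftrightarrow> \<rho> x \<in> C" if "x \<in> topspace X" for x
    using lift[OF that] inj_on_image_mem_iff[OF g(2) _ closedin_subset[OF C], of "\<rho> x"] by simp
  then have "{x \<in> topspace X. q x \<in> g ` C} = {x \<in> topspace X. \<rho> x \<in> C}" by blast
  ultimately show "closedin X {x \<in> topspace X. \<rho> x \<in> C}" by simp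
qed

section \<open>Countable bases and countable separating families\<close>

lemma second_countable_dense_subset:
  assumes "second_countable X" "S \<subseteq> topspace X"
  obtains W where "countable W" "W \<subseteq> S" "S \<subseteq> X closure_of W"
proof -
  have "separable_space (subtopology X S)"
    using assms second_countable_subtopology second_countable_imp_separable_space by blast
  then obtain W where "countable W" "W \<subseteq> S" "subtopology X S closure_of W = S"
    unfolding separable_space_def using assms(2) by (auto simp: Int_absorb1)
  then show thesis
    using that[of W] closure_of_subtopology_subset[of X S W] by simp
qed

lemma second_countable_euclidean: "second_countable (euclidean :: 'a::second_countable_topology topology)"
proof -
  obtain B :: "'a set set" where B: "countable B" "topological_basis B"
    using ex_countable_basis[where 'a = 'a] by auto
  have "\<exists>V\<in>B. x \<in> V \<and> V \<subseteq> U" if "open U" "x \<in> U" for U x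
    by (rule topological_basisE[OF B(2) that]) auto
  then show ?thesis
    unfolding second_countable_def using B(1) topological_basis_open[OF B(2)]
    by (intro exI[of _ B]) simp
qed

lemma second_countable_injective_image:
  assumes "compact_space X" "Hausdorff_space P" "second_countable P"
    and "continuous_map X P g" "inj_on g (topspace X)"
  shows "second_countable X"
proof -
  have "embedding_map X P g"
    using assms continuous_imp_closed_map injective_closed_imp_embedding_map by blast
  then have "X homeomorphic_space subtopology P (g ` topspace X)"
    by (rule embedding_map_imp_homeomorphic_space)
  then show ?thesis
    using assms(3) homeomorphic_space_second_countability second_countable_subtopology by metis
qed

text \<open>An enumeration bundles the functions into one map to the real sequences, a fixed type
  whose Euclidean topology is the product topology and is both second countable and
  Hausdorff.\<close>

lemma countable_family_map:
  fixes X :: "'a topology" and F :: "('a \<Rightarrow> real) set"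
  assumes "countable F" "\<And>f. f \<in> F \<Longrightarrow> continuous_map X euclideanreal f"
  shows "\<exists>g :: 'a \<Rightarrow> nat \<Rightarrow> real. continuous_map X euclidean g \<and>
    (\<forall>x y. g x = g y \<longleftrightarrow> (\<forall>f\<in>F. f x = f y))"
proof (cases "F = {}")
  case True
  then show ?thesis by (intro exI[of _ "\<lambda>_ _. 0"]) simp
next
  case False
  let ?g = "\<lambda>x n. from_nat_into F n x"
  have "continuous_map X (product_topology (\<lambda>_. euclideanreal) UNIV) ?g"
    using assms(2) from_nat_into[OF False] by (auto simp: continuous_map_componentwise)
  then have "continuous_map X euclidean ?g"
    by (simp add: euclidean_product_topology)
  moreover have "?g x = ?g y \<longleftrightarrow> (\<forall>f\<in>F. f x = f y)" for x y
  proof -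
    have "?g x = ?g y \<longleftrightarrow> (\<forall>f\<in>range (from_nat_into F). f x = f y)" by (auto simp: fun_eq_iff)
    then show ?thesis using range_from_nat_into[OF False assms(1)] by simp
  qed
  ultimately show ?thesis by (intro exI[of _ ?g]) simp
qed

text \<open>The countable step of Urysohn metrization: one function for each pair of basic sets with
  disjoint closures. Normality puts such a pair around any two distinct points.\<close>

lemma countable_separating_family:
  assumes "compact_space X" "Hausdorff_space X" "second_countable X"
  obtains F :: "('a \<Rightarrow> real) set"
    where "countable F" "\<And>f. f \<in> F \<Longrightarrow> continuous_map X (top_of_set {0..1}) f"
      "\<And>x y. x \<in> topspace X \<Longrightarrow> y \<in> topspace X \<Longrightarrow> (\<And>f. f \<in> F \<Longrightarrow> f x = f y) \<Longrightarrow> x = y"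
proof -
  obtain B where B: "countable B" "\<And>V. V \<in> B \<Longrightarrow> openin X V"
    "\<And>U x. openin X U \<Longrightarrow> x \<in> U \<Longrightarrow> \<exists>V\<in>B. x \<in> V \<and> V \<subseteq> U"
    using assms(3) by (auto simp: second_countable_def)
  have normal: "normal_space X"
    using assms compact_Hausdorff_or_regular_imp_normal_space by blast
  define J where "J = {(U, V) \<in> B \<times> B. disjnt (X closure_of U) (X closure_of V)}"
  define Q where "Q P f \<longleftrightarrow> continuous_map X (top_of_set {0..1::real}) f \<and>
      f ` (X closure_of fst P) \<subseteq> {0} \<and> f ` (X closure_of snd P) \<subseteq> {1}" for P f
  have "\<exists>f. Q P f" if "P \<in> J" for P
  proof -
    from that have "disjnt (X closure_of fst P) (X closure_of snd P)" by (auto simp: J_def)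
    then obtain f where "continuous_map X (top_of_set {0..1::real}) f"
      "f ` (X closure_of fst P) \<subseteq> {0}" "f ` (X closure_of snd P) \<subseteq> {1}"
      by (rule Urysohn_lemma[OF normal closedin_closure_of closedin_closure_of _ zero_le_one])
    then show ?thesis unfolding Q_def by blast
  qed
  then obtain h where h: "\<And>P. P \<in> J \<Longrightarrow> Q P (h P)"
    by metis
  have "countable J"
    by (rule countable_subset[of _ "B \<times> B"]) (use B(1) in \<open>auto simp: J_def\<close>)
  moreover have "x = y" if xy: "x \<in> topspace X" "y \<in> topspace X"
    and eq: "\<And>f. f \<in> h ` J \<Longrightarrow> f x = f y" for x y
  proof (rule ccontr)
    assume "x \<noteq> y"
    then have "closedin X {x}" "closedin X {y}" "disjnt {x} {y}"
      using assms xy by (auto simp: closedin_Hausdorff_singleton)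
    then obtain U V where UV: "openin X U" "openin X V" "x \<in> U" "y \<in> V"
      "disjnt (X closure_of U) (X closure_of V)"
      using normal unfolding normal_space_disjoint_closures by (metis insert_subset)
    obtain U' V' where B': "U' \<in> B" "V' \<in> B" "x \<in> U'" "y \<in> V'" "U' \<subseteq> U" "V' \<subseteq> V"
      using B(3) UV by metis
    then have J': "(U', V') \<in> J"
      using disjnt_subset1[OF disjnt_subset2[OF UV(5) closure_of_mono] closure_of_mono]
      by (simp add: J_def)
    have "x \<in> X closure_of U'" "y \<in> X closure_of V'"
      using B B' xy by (meson closure_of_subset openin_subset subsetD)+
    then have "h (U', V') x = 0" "h (U', V') y = 1"
      using h[OF J'] by (auto simp: Q_def)
    then show False using eq[of "h (U', V')"] J' by force
  qed
  moreover have "continuous_map X (top_of_set {0..1}) f" if "f \<in> h ` J" for f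
    using that h by (auto simp only: Q_def)
  ultimately show thesis using that[of "h ` J"] \<open>countable J\<close> by blast
qed

text \<open>Choose a basic neighbourhood of \<open>z a\<close> that misses \<open>C a\<close>. If
  \<open>a\<close> and \<open>b\<close> received the same one, neither \<open>z a\<close> could lie
  in \<open>C b\<close> nor \<open>z b\<close> in \<open>C a\<close>. Hence the choice is injective
  into a countable base.\<close>

lemma countable_strict_closed_chain:
  assumes "second_countable X"
    and C: "\<And>a. a \<in> N \<Longrightarrow> closedin X (C a)"
    and z: "\<And>a. a \<in> N \<Longrightarrow> z a \<in> topspace X - C a"
    and chain: "\<And>a b. a \<in> N \<Longrightarrow> b \<in> N \<Longrightarrow> a \<noteq> b \<Longrightarrow> z a \<in> C b \<or> z b \<in> C a"
  shows "countable N"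
proof -
  obtain B where B: "countable B"
    "\<And>U x. openin X U \<Longrightarrow> x \<in> U \<Longrightarrow> \<exists>V\<in>B. x \<in> V \<and> V \<subseteq> U"
    using assms(1) by (auto simp: second_countable_def)
  have "\<exists>V\<in>B. z a \<in> V \<and> V \<subseteq> topspace X - C a" if "a \<in> N" for a
    using B(2)[of "topspace X - C a"] C[OF that] z[OF that] by (simp add: openin_diff)
  then obtain V where V: "\<And>a. a \<in> N \<Longrightarrow> V a \<in> B \<and> z a \<in> V a \<and> V a \<subseteq> topspace X - C a"
    by metis
  have "inj_on V N"
    by (rule inj_onI) (metis V chain DiffE subsetD)
  moreover have "countable (V ` N)"
    by (rule countable_subset[OF _ B(1)]) (use V in auto)
  ultimately show ?thesis by (metis countable_image_inj_on)
qed

text \<open>The canonical map is a continuous injection from a compact space to a Hausdorff one, so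
  surjectivity decides. A thread is hit because the fibres over its components form a filtered
  family of nonempty closed sets. This serves both the limit over the whole index set and the limits
  over countable subsets.\<close>

lemma is_inverse_limit_directed:
  assumes "compact_space X"
    and "D \<noteq> {}" and directed: "\<And>s t. s \<in> D \<Longrightarrow> t \<in> D \<Longrightarrow> \<exists>u\<in>D. (s, u) \<in> le \<and> (t, u) \<in> le"
    and Y: "\<And>s. s \<in> D \<Longrightarrow> Hausdorff_space (Y s)"
    and p: "\<And>s. s \<in> D \<Longrightarrow> continuous_map X (Y s) (p s)"
    and surj: "\<And>s. s \<in> D \<Longrightarrow> p s ` topspace X = topspace (Y s)"
    and compat: "\<And>s t x. s \<in> D \<Longrightarrow> t \<in> D \<Longrightarrow> (s, t) \<in> le \<Longrightarrow> x \<in> topspace X \<Longrightarrow> r s t (p t x) = p s x"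
    and sep: "\<And>x y. x \<in> topspace X \<Longrightarrow> y \<in> topspace X \<Longrightarrow> (\<And>s. s \<in> D \<Longrightarrow> p s x = p s y) \<Longrightarrow> x = y"
  shows "is_inverse_limit X p D le Y r"
  unfolding is_inverse_limit_def
proof (rule continuous_imp_homeomorphic_map)
  let ?g = "\<lambda>x. \<lambda>s\<in>D. p s x"
  let ?L = "{x. \<forall>s\<in>D. \<forall>t\<in>D. (s, t) \<in> le \<longrightarrow> r s t (x t) = x s}"
  have "continuous_map X (product_topology Y D) ?g"
    using p by (auto simp: continuous_map_componentwise)
  then show "continuous_map X (inverse_limit D le Y r) ?g"
    unfolding inverse_limit_def by (auto simp: continuous_map_in_subtopology compat)
  show "Hausdorff_space (inverse_limit D le Y r)"
    unfolding inverse_limit_def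
    by (simp add: Hausdorff_space_subtopology Hausdorff_space_product_topology Y)
  show "inj_on ?g (topspace X)"
    by (rule inj_onI, rule sep) (auto simp: fun_eq_iff restrict_def split: if_splits)
  have "z \<in> ?g ` topspace X" if z: "z \<in> topspace (inverse_limit D le Y r)" for z
  proof -
    have zY: "\<And>s. s \<in> D \<Longrightarrow> z s \<in> topspace (Y s)" and zD: "z \<in> extensional D"
      and zr: "\<And>s t. s \<in> D \<Longrightarrow> t \<in> D \<Longrightarrow> (s, t) \<in> le \<Longrightarrow> r s t (z t) = z s"
      using z by (auto simp: inverse_limit_def PiE_iff)
    have "\<exists>x\<in>topspace X. \<forall>s\<in>D. x \<in> {x \<in> topspace X. p s x \<in> {z s}}"
    proof (rule compact_space_directed_Inter[OF \<open>compact_space X\<close> \<open>D \<noteq> {}\<close>])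
      show "closedin X {x \<in> topspace X. p s x \<in> {z s}}" if "s \<in> D" for s
        using that by (intro closedin_continuous_map_preimage[OF p]) (auto simp: closedin_Hausdorff_singleton Y zY)
      show "{x \<in> topspace X. p s x \<in> {z s}} \<noteq> {}" if "s \<in> D" for s
        using surj[OF that] zY[OF that] by force
      fix s t assume st: "s \<in> D" "t \<in> D"
      then obtain u where u: "u \<in> D" "(s, u) \<in> le" "(t, u) \<in> le" using directed by blast
      then show "\<exists>u\<in>D. {x \<in> topspace X. p u x \<in> {z u}} \<subseteq>
          {x \<in> topspace X. p s x \<in> {z s}} \<inter> {x \<in> topspace X. p t x \<in> {z t}}"
        using st compat zr by (intro bexI[of _ u]) (auto; metis)
    qed
    then obtain x where "x \<in> topspace X" "\<forall>s\<in>D. p s x = z s" by auto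
    then show ?thesis using zD by (intro image_eqI[of _ _ x]) (auto simp: extensional_def restrict_def fun_eq_iff)
  qed
  moreover have "?g x \<in> topspace (inverse_limit D le Y r)" if "x \<in> topspace X" for x
    using that p continuous_map_image_subset_topspace compat by (fastforce simp: inverse_limit_def)
  ultimately show "?g ` topspace X = topspace (inverse_limit D le Y r)" by blast
qed (rule assms(1))

section \<open>From Valdivia embeddings to skeletons\<close>

text \<open>The coordinate functions of a Valdivia embedding, with the set of functions as its own
  exponent. The last clause is the density of the preimage of the Sigma-product.\<close>

definition sigma_family :: "'a topology \<Rightarrow> ('a \<Rightarrow> real) set \<Rightarrow> bool" where
  "sigma_family X F \<longleftrightarrow>
     (\<forall>f\<in>F. continuous_map X (top_of_set {0..1}) f) \<and>
     (\<forall>x\<in>topspace X. \<forall>y\<in>topspace X. (\<forall>f\<in>F. f x = f y) \<longrightarrow> x = y) \<and>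
     X closure_of {x \<in> topspace X. countable {f \<in> F. f x \<noteq> 0}} = topspace X"

lemma Hausdorff_space_unit_cube: "Hausdorff_space (unit_cube T)"
  unfolding unit_cube_def
  by (simp add: Hausdorff_space_product_topology Hausdorff_space_subtopology Hausdorff_space_euclidean)

lemma sigma_family_imp_valdivia_compact:
  assumes "compact_space X" "Hausdorff_space X" "sigma_family X F"
  shows "valdivia_compact X"
proof -
  let ?h = "\<lambda>x. \<lambda>f\<in>F. f x"
  let ?D = "{x \<in> topspace X. countable {f \<in> F. f x \<noteq> 0}}"
  have cont: "continuous_map X (unit_cube F) ?h"
    using assms(3) by (auto simp: unit_cube_def continuous_map_componentwise sigma_family_def)
  have inj: "inj_on ?h (topspace X)"
    using assms(3) by (auto simp: sigma_family_def inj_on_def fun_eq_iff restrict_def; metis)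
  have "embedding_map X (unit_cube F) ?h"
    using continuous_imp_closed_map[OF cont assms(1) Hausdorff_space_unit_cube] cont inj
    by (simp add: injective_closed_imp_embedding_map)
  moreover have "closedin (unit_cube F) (?h ` topspace X)"
    using compactin_imp_closedin[OF Hausdorff_space_unit_cube image_compactin[OF _ cont]] assms(1)
    by (simp add: compact_space_def)
  then have "unit_cube F closure_of (Sigma_product F \<inter> ?h ` topspace X) \<subseteq> ?h ` topspace X"
    by (simp add: closure_of_minimal)
  moreover have "?h ` topspace X \<subseteq> unit_cube F closure_of (Sigma_product F \<inter> ?h ` topspace X)"
  proof -
    have "countable {f \<in> F. ?h x f \<noteq> 0}" if "x \<in> ?D" for x
    proof -
      have "{f \<in> F. ?h x f \<noteq> 0} = {f \<in> F. f x \<noteq> 0}" by auto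
      with that show ?thesis by simp
    qed
    then have "?h ` ?D \<subseteq> Sigma_product F \<inter> ?h ` topspace X"
      using continuous_map_image_subset_topspace[OF cont] by (auto simp: Sigma_product_def)
    moreover have "?h ` topspace X \<subseteq> unit_cube F closure_of (?h ` ?D)"
      using continuous_map_image_closure_subset[OF cont, of ?D] assms(3) by (simp add: sigma_family_def)
    ultimately show ?thesis by (meson closure_of_mono subset_trans)
  qed
  ultimately have "valdivia_embedding X F ?h"
    unfolding valdivia_embedding_def by blast
  then show ?thesis unfolding valdivia_compact_def using assms by blast
qed

lemma valdivia_embedding_imp_sigma_family:
  assumes "valdivia_embedding X T h"
  shows "\<exists>F. sigma_family X F"
proof -
  let ?F = "(\<lambda>k x. h x k) ` T"
  let ?E = "{x \<in> topspace X. countable {k \<in> T. h x k \<noteq> 0}}"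
  have hom: "homeomorphic_map X (subtopology (unit_cube T) (h ` topspace X)) h"
    and dense: "h ` topspace X = unit_cube T closure_of (Sigma_product T \<inter> h ` topspace X)"
    using assms by (auto simp: valdivia_embedding_def embedding_map_def)
  have cont: "continuous_map X (unit_cube T) h"
    using homeomorphic_imp_continuous_map[OF hom] continuous_map_in_subtopology by blast
  have inj: "inj_on h (topspace X)"
    using homeomorphic_imp_injective_map[OF hom] .
  have hX: "h ` topspace X \<subseteq> topspace (unit_cube T)"
    using continuous_map_image_subset_topspace[OF cont] .
  have "h ` ?E = Sigma_product T \<inter> h ` topspace X"
    using hX by (auto simp: Sigma_product_def)
  moreover have "h ` topspace X \<inter> (Sigma_product T \<inter> h ` topspace X) = Sigma_product T \<inter> h ` topspace X"
    by auto
  ultimately have "h ` (X closure_of ?E) = h ` topspace X"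
    using homeomorphic_map_closure_of[OF hom, of ?E] dense closure_of_subtopology[of "unit_cube T" "h ` topspace X"]
    by simp
  then have E: "X closure_of ?E = topspace X"
    using inj_on_image_eq_iff[OF inj closure_of_subset_topspace subset_refl] by blast
  \<comment> \<open>Only an inclusion can be expected: uncountably many nonzero indices of
    \<open>T\<close> may share one coordinate function, which counts once in
    \<open>?F\<close>.\<close>
  have "?E \<subseteq> {x \<in> topspace X. countable {f \<in> ?F. f x \<noteq> 0}}"
  proof clarify
    fix x assume "countable {k \<in> T. h x k \<noteq> 0}"
    then have "countable ((\<lambda>k x. h x k) ` {k \<in> T. h x k \<noteq> 0})" by simp
    then show "countable {f \<in> ?F. f x \<noteq> 0}"
      by (rule countable_subset[rotated]) auto
  qed
  from closure_of_mono[OF this, of X]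
  have "X closure_of {x \<in> topspace X. countable {f \<in> ?F. f x \<noteq> 0}} = topspace X"
    unfolding E by (simp add: closure_of_subset_topspace subset_antisym)
  moreover have "\<forall>f\<in>?F. continuous_map X (top_of_set {0..1}) f"
    using cont by (auto simp: unit_cube_def continuous_map_componentwise)
  moreover have "x = y" if "x \<in> topspace X" "y \<in> topspace X" "\<forall>f\<in>?F. f x = f y" for x y
  proof (rule inj_onD[OF inj _ that(1,2)])
    have "h x \<in> extensional T" "h y \<in> extensional T"
      using hX that by (auto simp: unit_cube_def PiE_def)
    then show "h x = h y" using that(3) by (auto intro: extensionalityI)
  qed
  ultimately have "sigma_family X ?F" unfolding sigma_family_def by simp
  then show ?thesis ..
qed

section \<open>Retractions that set coordinates to zero\<close>

locale sigma_space =
  fixes X :: "'a topology" and F :: "('a \<Rightarrow> real) set"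
  assumes compact: "compact_space X" and Hausdorff: "Hausdorff_space X"
    and sigma: "sigma_family X F"
begin

lemma continuous_family: "f \<in> F \<Longrightarrow> continuous_map X euclideanreal f"
  using sigma continuous_map_in_subtopology unfolding sigma_family_def by blast

lemma family_eqI:
  "x \<in> topspace X \<Longrightarrow> y \<in> topspace X \<Longrightarrow> (\<And>f. f \<in> F \<Longrightarrow> f x = f y) \<Longrightarrow> x = y"
  using sigma unfolding sigma_family_def by simp

definition sigma_part :: "'a set" where
  "sigma_part = {x \<in> topspace X. countable {f \<in> F. f x \<noteq> 0}}"

lemma sigma_part_dense: "X closure_of sigma_part = topspace X"
  using sigma by (simp add: sigma_family_def sigma_part_def)

lemma closedin_family_eq: "closedin X {y \<in> topspace X. \<forall>f\<in>S. f y = c f}" if "S \<subseteq> F"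
proof (cases "S = {}")
  case False
  have "closedin X {y \<in> topspace X. f y \<in> {c f}}" if "f \<in> S" for f
    using that \<open>S \<subseteq> F\<close> by (intro closedin_continuous_map_preimage[OF continuous_family]) auto
  then have "closedin X (\<Inter>f\<in>S. {y \<in> topspace X. f y \<in> {c f}})"
    using False by (intro closedin_Inter) auto
  also have "(\<Inter>f\<in>S. {y \<in> topspace X. f y \<in> {c f}}) = {y \<in> topspace X. \<forall>f\<in>S. f y = c f}"
    using False by auto
  finally show ?thesis .
qed simp

definition adequate :: "('a \<Rightarrow> real) set \<Rightarrow> bool" where
  "adequate S \<longleftrightarrow> (\<forall>x\<in>topspace X. \<exists>y\<in>topspace X. \<forall>f\<in>F. f y = (if f \<in> S then f x else 0))"

text \<open>For adequate \<open>S\<close> and \<open>x\<close> in \<open>X\<close> the choice is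
  forced, since \<open>F\<close> separates points. Identities between retractions are therefore
  checked coordinate by coordinate.\<close>

definition ret :: "('a \<Rightarrow> real) set \<Rightarrow> 'a \<Rightarrow> 'a" where
  "ret S x = (SOME y. y \<in> topspace X \<and> (\<forall>f\<in>F. f y = (if f \<in> S then f x else 0)))"

lemma ret:
  assumes "adequate S" "x \<in> topspace X"
  shows "ret S x \<in> topspace X" and "\<And>f. f \<in> F \<Longrightarrow> f (ret S x) = (if f \<in> S then f x else 0)"
proof -
  have "\<exists>y. y \<in> topspace X \<and> (\<forall>f\<in>F. f y = (if f \<in> S then f x else 0))"
    using assms unfolding adequate_def by blast
  from someI_ex[OF this]
  show "ret S x \<in> topspace X" and "\<And>f. f \<in> F \<Longrightarrow> f (ret S x) = (if f \<in> S then f x else 0)"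
    unfolding ret_def by blast+
qed

lemma continuous_map_ret:
  assumes "adequate S"
  shows "continuous_map X X (ret S)"
proof (rule continuous_map_lift_injective[where P = "product_topology (\<lambda>_. euclideanreal) F"
      and g = "\<lambda>x. \<lambda>f\<in>F. f x" and q = "\<lambda>x. \<lambda>f\<in>F. if f \<in> S then f x else 0"])
  show "Hausdorff_space (product_topology (\<lambda>_. euclideanreal) F)"
    by (simp add: Hausdorff_space_product_topology Hausdorff_space_euclidean)
  show "continuous_map X (product_topology (\<lambda>_. euclideanreal) F) (\<lambda>x. \<lambda>f\<in>F. f x)"
    using continuous_family by (auto simp: continuous_map_componentwise)
  have "continuous_map X euclideanreal (\<lambda>x. if f \<in> S then f x else 0)" if "f \<in> F" for f
    using continuous_family[OF that] by (cases "f \<in> S") auto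
  then show "continuous_map X (product_topology (\<lambda>_. euclideanreal) F) (\<lambda>x. \<lambda>f\<in>F. if f \<in> S then f x else 0)"
    by (auto simp: continuous_map_componentwise)
  show "inj_on (\<lambda>x. \<lambda>f\<in>F. f x) (topspace X)"
    by (rule inj_onI, rule family_eqI) (auto simp: fun_eq_iff restrict_def split: if_splits)
  fix x assume "x \<in> topspace X"
  with ret[OF assms this] show "ret S x \<in> topspace X \<and> (\<lambda>f\<in>F. f (ret S x)) = (\<lambda>f\<in>F. if f \<in> S then f x else 0)"
    by (auto simp: restrict_def)
qed (rule compact)

lemma ret_ret:
  assumes "adequate S" "adequate T" "x \<in> topspace X"
  shows "ret S (ret T x) = ret T (ret S x)" and "S \<subseteq> T \<Longrightarrow> ret S (ret T x) = ret S x"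
  using assms by (auto intro!: family_eqI simp: ret)

text \<open>Membership in \<open>C\<close> supplies the zeros outside the union, and the
  approximations prescribe ever more coordinates inside it. Compactness merges them into one point.
  The approximations come from a dense set in the closing-off argument, and from the retractions
  themselves for directed unions.\<close>

lemma adequate_Union_closedin:
  assumes "\<D> \<noteq> {}" "\<Union>\<D> \<subseteq> F" and CX: "closedin X C"
  and directed: "\<And>S T. S \<in> \<D> \<Longrightarrow> T \<in> \<D> \<Longrightarrow> \<exists>U\<in>\<D>. S \<union> T \<subseteq> U"
  and C: "\<And>x f. x \<in> C \<Longrightarrow> f \<in> F - \<Union>\<D> \<Longrightarrow> f x = 0"
  and ex: "\<And>S x. S \<in> \<D> \<Longrightarrow> x \<in> topspace X \<Longrightarrow> \<exists>y\<in>C. \<forall>f\<in>S. f y = f x"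
  shows "adequate (\<Union>\<D>)"
  unfolding adequate_def
proof
  fix x assume x: "x \<in> topspace X"
  have "\<exists>y\<in>topspace X. \<forall>S\<in>\<D>. y \<in> C \<inter> {y \<in> topspace X. \<forall>f\<in>S. f y = f x}"
  proof (rule compact_space_directed_Inter[OF compact \<open>\<D> \<noteq> {}\<close>])
    show "closedin X (C \<inter> {y \<in> topspace X. \<forall>f\<in>S. f y = f x})" if "S \<in> \<D>" for S
      using that assms(2) by (intro closedin_Int CX closedin_family_eq) auto
    show "C \<inter> {y \<in> topspace X. \<forall>f\<in>S. f y = f x} \<noteq> {}" if "S \<in> \<D>" for S
      using ex[OF that x] closedin_subset[OF CX] by auto
    fix S T assume "S \<in> \<D>" "T \<in> \<D>"
    then obtain U where "U \<in> \<D>" "S \<union> T \<subseteq> U" using directed by blast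
    then show "\<exists>U\<in>\<D>. C \<inter> {y \<in> topspace X. \<forall>f\<in>U. f y = f x} \<subseteq>
        (C \<inter> {y \<in> topspace X. \<forall>f\<in>S. f y = f x}) \<inter> (C \<inter> {y \<in> topspace X. \<forall>f\<in>T. f y = f x})"
      by (intro bexI[of _ U]) auto
  qed
  then obtain y where y: "y \<in> topspace X" "\<forall>S\<in>\<D>. y \<in> C \<and> (\<forall>f\<in>S. f y = f x)" by auto
  then have "y \<in> C" using \<open>\<D> \<noteq> {}\<close> by blast
  then show "\<exists>y\<in>topspace X. \<forall>f\<in>F. f y = (if f \<in> \<Union>\<D> then f x else 0)"
    using y C by (intro bexI[of _ y]) auto
qed

section \<open>Cofinality of the countable adequate sets\<close>

text \<open>The image of \<open>sigma_part\<close> under the countably many coordinates in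
  \<open>A\<close> has a countable dense subset, and \<open>E\<close> lifts it. The image of a
  closed \<open>C\<close> containing \<open>E\<close> is closed and contains a dense part of the
  image of \<open>X\<close>, hence all of it. The quantifier over \<open>C\<close> lets
  \<open>E\<close> be chosen before the relevant zero set is known.\<close>

lemma countable_dense_family_image:
  assumes "countable A" "A \<subseteq> F"
  shows "\<exists>E. countable E \<and> E \<subseteq> sigma_part \<and>
    (\<forall>C. closedin X C \<longrightarrow> E \<subseteq> C \<longrightarrow> (\<forall>x\<in>topspace X. \<exists>y\<in>C. \<forall>f\<in>A. f y = f x))"
proof -
  obtain g :: "'a \<Rightarrow> nat \<Rightarrow> real" where g: "continuous_map X euclidean g"
    and g_eq: "\<forall>x y. g x = g y \<longleftrightarrow> (\<forall>f\<in>A. f x = f y)"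
    using countable_family_map[of A X] assms continuous_family by auto
  obtain W where W: "countable W" "W \<subseteq> g ` sigma_part" "g ` sigma_part \<subseteq> euclidean closure_of W"
    using second_countable_dense_subset[OF second_countable_euclidean, of "g ` sigma_part"] by auto
  obtain E where E: "countable E" "E \<subseteq> sigma_part" "W = g ` E"
    using W(1,2) by (metis countable_subset_image)
  have "\<exists>y\<in>C. \<forall>f\<in>A. f y = f x" if C: "closedin X C" "E \<subseteq> C" and x: "x \<in> topspace X" for C x
  proof -
    have "closedin euclidean (g ` C)"
      using continuous_imp_closed_map[OF g compact Hausdorff_space_euclidean] C(1)
      by (simp add: closed_map_def)
    then have "euclidean closure_of W \<subseteq> g ` C"
      using E(3) C(2) by (intro closure_of_minimal) auto
    moreover have "g x \<in> euclidean closure_of (g ` sigma_part)"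
      using continuous_map_image_closure_subset[OF g, of sigma_part] x sigma_part_dense by auto
    moreover have "euclidean closure_of (g ` sigma_part) \<subseteq> euclidean closure_of W"
      using W(3) by (intro closure_of_minimal) auto
    ultimately have "g x \<in> g ` C" by blast
    then obtain y where "y \<in> C" "g y = g x" by auto
    then show ?thesis using g_eq by metis
  qed
  then show ?thesis using E by blast
qed

text \<open>Each stage adds the supports of the witnesses for the previous stage; these are
  countable because the witnesses lie in \<open>sigma_part\<close>. After countably many stages the
  supports of all witnesses have been absorbed.\<close>

lemma adequate_cofinal:
  assumes "countable A" "A \<subseteq> F"
  obtains S where "A \<subseteq> S" "S \<subseteq> F" "countable S" "adequate S"
proof -
  define Q where "Q A E \<longleftrightarrow> countable E \<and> E \<subseteq> sigma_part \<and>
    (\<forall>C. closedin X C \<longrightarrow> E \<subseteq> C \<longrightarrow> (\<forall>x\<in>topspace X. \<exists>y\<in>C. \<forall>f\<in>A. f y = f x))"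
    for A :: "('a \<Rightarrow> real) set" and E
  have "\<exists>E. countable A \<and> A \<subseteq> F \<longrightarrow> Q A E" for A
    unfolding Q_def using countable_dense_family_image[of A] by blast
  then obtain E where E: "\<And>A. countable A \<Longrightarrow> A \<subseteq> F \<Longrightarrow> Q A (E A)"
    by metis
  define B where "B = rec_nat A (\<lambda>_ B. B \<union> (\<Union>x\<in>E B. {f \<in> F. f x \<noteq> 0}))"
  have B0: "B 0 = A" and BS: "\<And>n. B (Suc n) = B n \<union> (\<Union>x\<in>E (B n). {f \<in> F. f x \<noteq> 0})"
    by (simp_all add: B_def)
  have B: "countable (B n) \<and> B n \<subseteq> F" for n
  proof (induction n)
    case (Suc n)
    then have "Q (B n) (E (B n))" using E by simp
    then have "countable (\<Union>x\<in>E (B n). {f \<in> F. f x \<noteq> 0})"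
      unfolding Q_def by (intro countable_UN) (auto simp: sigma_part_def)
    with Suc show ?case by (auto simp: BS)
  qed (simp add: B0 assms)
  then have QB: "Q (B n) (E (B n))" for n using E by simp
  have mono: "B m \<subseteq> B n" if "m \<le> n" for m n
    using lift_Suc_mono_le[of B m n] that by (simp add: BS)
  let ?S = "\<Union>(range B)"
  \<comment> \<open>The witnesses of every stage lie in this zero set, so each of its images under
    the coordinates in \<open>B n\<close> is already that of the whole space.\<close>
  let ?C = "{y \<in> topspace X. \<forall>f\<in>F - ?S. f y = 0}"
  have "adequate ?S"
  proof (rule adequate_Union_closedin[where C = ?C])
    show "closedin X ?C" by (rule closedin_family_eq) auto
    show "\<exists>U\<in>range B. S \<union> T \<subseteq> U" if "S \<in> range B" "T \<in> range B" for S T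
    proof -
      from that obtain m n where "S = B m" "T = B n" by auto
      then show ?thesis using mono[of m "max m n"] mono[of n "max m n"] by auto
    qed
    fix S x assume S: "S \<in> range B" and x: "x \<in> topspace X"
    then obtain n where n: "S = B n" by auto
    have "E (B n) \<subseteq> ?C"
    proof
      fix d assume d: "d \<in> E (B n)"
      then have "d \<in> topspace X" using QB[of n] by (auto simp: Q_def sigma_part_def)
      moreover have "f d = 0" if "f \<in> F" "f \<notin> ?S" for f
        using that d BS[of n] by blast
      ultimately show "d \<in> ?C" by auto
    qed
    moreover have "closedin X ?C" by (rule closedin_family_eq) auto
    ultimately show "\<exists>y\<in>?C. \<forall>f\<in>S. f y = f x"
      using QB[of n] x n unfolding Q_def by blast
  qed (use B in auto)
  moreover have "A \<subseteq> ?S" using B0 by blast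
  moreover have "?S \<subseteq> F" using B by blast
  moreover have "countable ?S" using B by (intro countable_UN) auto
  ultimately show thesis using that[of ?S] by simp
qed

text \<open>The approximation on \<open>S\<close> is \<open>ret S x\<close>, which vanishes outside
  \<open>S\<close> and so outside the union. Sigma-completeness rests on this.\<close>

lemma adequate_directed_Union:
  assumes "\<D> \<noteq> {}" "\<And>S. S \<in> \<D> \<Longrightarrow> S \<subseteq> F \<and> adequate S"
  and directed: "\<And>S T. S \<in> \<D> \<Longrightarrow> T \<in> \<D> \<Longrightarrow> \<exists>U\<in>\<D>. S \<union> T \<subseteq> U"
  shows "adequate (\<Union>\<D>)"
proof (rule adequate_Union_closedin[where C = "{y \<in> topspace X. \<forall>f\<in>F - \<Union>\<D>. f y = 0}"])
  show "closedin X {y \<in> topspace X. \<forall>f\<in>F - \<Union>\<D>. f y = 0}"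
    by (rule closedin_family_eq) auto
  show "\<exists>y\<in>{y \<in> topspace X. \<forall>f\<in>F - \<Union>\<D>. f y = 0}. \<forall>f\<in>S. f y = f x"
    if "S \<in> \<D>" "x \<in> topspace X" for S x
  proof -
    have S: "adequate S" "S \<subseteq> F" "S \<subseteq> \<Union>\<D>" using assms(2)[OF that(1)] that by auto
    have "f (ret S x) = f x" if "f \<in> S" for f
      using ret(2)[OF S(1) \<open>x \<in> topspace X\<close>, of f] that S(2) by auto
    moreover have "f (ret S x) = 0" if "f \<in> F - \<Union>\<D>" for f
      using ret(2)[OF S(1) \<open>x \<in> topspace X\<close>, of f] that S(3) by auto
    ultimately show ?thesis using ret(1)[OF S(1) that(2)] by (intro bexI[of _ "ret S x"]) auto
  qed
qed (use assms in auto)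

section \<open>The skeleton of fixed spaces\<close>

text \<open>For adequate \<open>S\<close> this is the image of \<open>ret S\<close>. Described by
  zeros it is closed for every \<open>S\<close> and visibly grows with \<open>S\<close>.\<close>

definition fixed_space :: "('a \<Rightarrow> real) set \<Rightarrow> 'a topology" where
  "fixed_space S = subtopology X {x \<in> topspace X. \<forall>f\<in>F - S. f x = 0}"

lemma topspace_fixed_space: "topspace (fixed_space S) = {x \<in> topspace X. \<forall>f\<in>F - S. f x = 0}"
  by (auto simp: fixed_space_def)

lemma fixed_space_zero:
  assumes "x \<in> topspace (fixed_space S)" "f \<in> F" "f \<notin> S"
  shows "f x = 0"
proof -
  have "\<forall>f\<in>F - S. f x = 0" using assms(1) by (simp add: topspace_fixed_space)
  then show ?thesis using assms(2,3) by (rule bspec[OF _ DiffI])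
qed

lemma fixed_space_mono: "S \<subseteq> T \<Longrightarrow> topspace (fixed_space S) \<subseteq> topspace (fixed_space T)"
  by (auto simp: topspace_fixed_space)

lemma compact_fixed_space: "compact_space (fixed_space S)"
  unfolding fixed_space_def
  by (intro compact_space_subtopology closedin_compact_space[OF compact] closedin_family_eq) auto

lemma Hausdorff_fixed_space: "Hausdorff_space (fixed_space S)"
  unfolding fixed_space_def by (rule Hausdorff_space_subtopology[OF Hausdorff])

lemma ret_in_fixed_space: "adequate S \<Longrightarrow> x \<in> topspace X \<Longrightarrow> ret S x \<in> topspace (fixed_space S)"
  by (auto simp: topspace_fixed_space ret)

lemma ret_fixed: "adequate S \<Longrightarrow> x \<in> topspace (fixed_space S) \<Longrightarrow> ret S x = x"
  by (rule family_eqI) (auto simp: topspace_fixed_space ret)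

lemma continuous_map_ret_fixed: "adequate S \<Longrightarrow> continuous_map X (fixed_space S) (ret S)"
  using continuous_map_ret ret_in_fixed_space
  by (auto simp: fixed_space_def continuous_map_in_subtopology)

lemma second_countable_fixed_space:
  assumes "countable S" "S \<subseteq> F"
  shows "second_countable (fixed_space S)"
proof -
  obtain g :: "'a \<Rightarrow> nat \<Rightarrow> real" where g: "continuous_map X euclidean g"
    and g_eq: "\<forall>x y. g x = g y \<longleftrightarrow> (\<forall>f\<in>S. f x = f y)"
    using countable_family_map[of S X] assms continuous_family by auto
  show ?thesis
  proof (rule second_countable_injective_image[OF compact_fixed_space Hausdorff_space_euclidean second_countable_euclidean])
    show "continuous_map (fixed_space S) euclidean g"
      unfolding fixed_space_def by (rule continuous_map_from_subtopology[OF g])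
    show "inj_on g (topspace (fixed_space S))"
    proof (rule inj_onI)
      fix x y assume xy: "x \<in> topspace (fixed_space S)" "y \<in> topspace (fixed_space S)" and "g x = g y"
      then have eq: "\<forall>f\<in>S. f x = f y" using g_eq by simp
      show "x = y"
      proof (rule family_eqI)
        show "f x = f y" if "f \<in> F" for f
          using bspec[OF eq, of f] fixed_space_zero[OF xy(1) that] fixed_space_zero[OF xy(2) that]
          by (cases "f \<in> S") simp_all
      qed (use xy in \<open>simp_all add: topspace_fixed_space\<close>)
    qed
  qed
qed

text \<open>All spaces are subspaces of \<open>X\<close>, bonding maps and projections are given by
  \<open>ret S\<close>, and right inverse and limit embeddings are inclusions. The commutativity
  condition thereby turns into that of the retractions.\<close>

lemma has_commutative_r_skeleton: "has_commutative_r_skeleton X"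
proof -
  define I where "I = {S. S \<subseteq> F \<and> countable S \<and> adequate S}"
  define le where "le = {(S, T) \<in> I \<times> I. S \<subseteq> T}"
  have le: "(S, T) \<in> le \<longleftrightarrow> S \<in> I \<and> T \<in> I \<and> S \<subseteq> T" for S T
    by (auto simp: le_def)
  have ad: "adequate S" if "S \<in> I" for S using that by (simp add: I_def)
  \<comment> \<open>Applied to the empty set, to \<open>S \<union> T\<close> and to
    \<open>{f}\<close>, this gives nonemptiness and directedness of \<open>I\<close> and the
    separation of points by the projections.\<close>
  have cof: "\<exists>S\<in>I. A \<subseteq> S" if A: "countable A" "A \<subseteq> F" for A
  proof -
    obtain S where "A \<subseteq> S" "S \<subseteq> F" "countable S" "adequate S"
      by (rule adequate_cofinal[OF A])
    then show ?thesis by (intro bexI[of _ S]) (simp_all add: I_def)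
  qed
  have dirI: "\<exists>U\<in>I. (S, U) \<in> le \<and> (T, U) \<in> le" if "S \<in> I" "T \<in> I" for S T
  proof -
    have "countable (S \<union> T)" "S \<union> T \<subseteq> F" using that by (auto simp: I_def)
    from cof[OF this] obtain U where "U \<in> I" "S \<union> T \<subseteq> U" ..
    then show ?thesis using that by (intro bexI[of _ U]) (simp_all add: le)
  qed
  have directed: "directed_set le I"
    unfolding directed_set_def using dirI cof[of "{}"] by auto
  have sub: "x \<in> topspace X" if "x \<in> topspace (fixed_space S)" for x S
    using that by (simp add: topspace_fixed_space)
  have cont: "continuous_map (fixed_space T) (fixed_space S) (ret S)" if "S \<in> I" for S T
    using continuous_map_ret_fixed[OF ad[OF that]] unfolding fixed_space_def
    by (rule continuous_map_from_subtopology)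
  have surj: "ret S ` topspace (fixed_space T) = topspace (fixed_space S)" if "(S, T) \<in> le" for S T
  proof -
    have ad_S: "adequate S" and "S \<subseteq> T" using that ad by (auto simp: le)
    then have "x \<in> ret S ` topspace (fixed_space T)" if "x \<in> topspace (fixed_space S)" for x
      using ret_fixed[OF ad_S that] subsetD[OF fixed_space_mono that] by (intro image_eqI[of _ _ x]) auto
    then show ?thesis using ret_in_fixed_space[OF ad_S] sub by blast
  qed
  have system: "inverse_system I le fixed_space (\<lambda>S T. ret S)"
    unfolding inverse_system_def
  proof (intro conjI allI impI ballI)
    show "partial_order_on I le"
      unfolding partial_order_on_def preorder_on_def
      by (auto simp: le_def refl_on_def trans_def antisym_def)
    show "ret S (ret T x) = ret S x" if "(S, T) \<in> le \<and> (T, U) \<in> le" "x \<in> topspace (fixed_space U)" for S T U x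
      using that by (intro ret_ret(2)) (auto simp: le ad sub)
    show "continuous_map (fixed_space T) (fixed_space S) (ret S)" if "(S, T) \<in> le" for S T
      using that by (intro cont) (simp add: le)
  qed (simp_all add: directed compact_fixed_space Hausdorff_fixed_space surj ret_fixed ad)
  have complete: "sigma_complete I le fixed_space (\<lambda>S T. ret S)"
    unfolding sigma_complete_def
  proof (intro allI impI, elim conjE)
    fix D assume D: "D \<subseteq> I" "countable D" "directed_set le D"
    let ?U = "\<Union>D"
    have ne: "D \<noteq> {}" and dirD: "\<And>S T. S \<in> D \<Longrightarrow> T \<in> D \<Longrightarrow> \<exists>V\<in>D. (S, V) \<in> le \<and> (T, V) \<in> le"
      using D(3) by (auto simp: directed_set_def)
    have "adequate ?U"
    proof (rule adequate_directed_Union[OF ne])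
      show "S \<subseteq> F \<and> adequate S" if "S \<in> D" for S using that D(1) by (auto simp: I_def)
      show "\<exists>V\<in>D. S \<union> T \<subseteq> V" if "S \<in> D" "T \<in> D" for S T
        using dirD[OF that] by (auto simp: le)
    qed
    moreover have "?U \<subseteq> F" using D(1) by (auto simp: I_def)
    moreover have "countable ?U"
      using countable_UN[OF D(2), of "\<lambda>S. S"] D(1) by (auto simp: I_def)
    ultimately have U: "?U \<in> I" by (simp add: I_def)
    have below: "(S, ?U) \<in> le" if "S \<in> D" for S using that D(1) U by (auto simp: le)
    have "is_supremum I le D ?U"
      unfolding is_supremum_def using U below by (auto simp: le)
    moreover have "is_inverse_limit (fixed_space ?U) ret D le fixed_space (\<lambda>S T. ret S)"
    proof (rule is_inverse_limit_directed[OF compact_fixed_space ne dirD Hausdorff_fixed_space])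
      show "continuous_map (fixed_space ?U) (fixed_space S) (ret S)" if "S \<in> D" for S
        using that D(1) by (intro cont) auto
      show "ret S ` topspace (fixed_space ?U) = topspace (fixed_space S)" if "S \<in> D" for S
        by (rule surj[OF below[OF that]])
      show "ret S (ret T x) = ret S x" if "(S, T) \<in> le" "x \<in> topspace (fixed_space ?U)" for S T x
        using that by (intro ret_ret(2)) (auto simp: le ad sub)
      fix x y assume xy: "x \<in> topspace (fixed_space ?U)" "y \<in> topspace (fixed_space ?U)"
        and eq: "\<And>S. S \<in> D \<Longrightarrow> ret S x = ret S y"
      have "f x = f y" if "f \<in> F" for f
      proof (cases "f \<in> ?U")
        case True
        then obtain S where S: "S \<in> D" "f \<in> S" by blast
        then have "adequate S" using D(1) ad by blast
        then have "f x = f (ret S x)" "f y = f (ret S y)"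
          using ret(2)[OF _ sub[OF xy(1)] that] ret(2)[OF _ sub[OF xy(2)] that] S(2) by simp_all
        with eq[OF S(1)] show ?thesis by simp
      next
        case False
        then show ?thesis using fixed_space_zero[OF xy(1) that] fixed_space_zero[OF xy(2) that] by simp
      qed
      then show "x = y" by (rule family_eqI[OF sub[OF xy(1)] sub[OF xy(2)]])
    qed
    ultimately show "\<exists>t. is_supremum I le D t \<and>
        is_inverse_limit (fixed_space t) (\<lambda>S. ret S) D le fixed_space (\<lambda>S T. ret S)"
      by blast
  qed
  have limit: "is_inverse_limit X ret I le fixed_space (\<lambda>S T. ret S)"
  proof (rule is_inverse_limit_directed[OF compact _ dirI Hausdorff_fixed_space])
    show "I \<noteq> {}" using cof[of "{}"] by auto
    show "continuous_map X (fixed_space S) (ret S)" if "S \<in> I" for S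
      by (rule continuous_map_ret_fixed[OF ad[OF that]])
    show "ret S ` topspace X = topspace (fixed_space S)" if "S \<in> I" for S
    proof -
      have "x \<in> ret S ` topspace X" if "x \<in> topspace (fixed_space S)" for x
        using ret_fixed[OF ad[OF \<open>S \<in> I\<close>] that] sub[OF that] by (intro image_eqI[of _ _ x]) auto
      then show ?thesis using ret_in_fixed_space[OF ad[OF that]] by blast
    qed
    show "ret S (ret T x) = ret S x" if "(S, T) \<in> le" "x \<in> topspace X" for S T x
      using that by (intro ret_ret(2)) (auto simp: le ad)
    fix x y assume xy: "x \<in> topspace X" "y \<in> topspace X" and eq: "\<And>S. S \<in> I \<Longrightarrow> ret S x = ret S y"
    have "f x = f y" if "f \<in> F" for f
    proof -
      obtain S where S: "S \<in> I" "f \<in> S" using cof[of "{f}"] \<open>f \<in> F\<close> by auto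
      then have "f x = f (ret S x)" "f y = f (ret S y)"
        using ret(2)[OF ad xy(1) that] ret(2)[OF ad xy(2) that] by simp_all
      with eq[OF S(1)] show ?thesis by simp
    qed
    then show "x = y" by (rule family_eqI[OF xy])
  qed
  have emb: "embedding_map (fixed_space S) (fixed_space T) (\<lambda>x. x)" if "(S, T) \<in> le" for S T
    using that unfolding embedding_map_def fixed_space_def le
    by (auto simp: subtopology_subtopology homeomorphic_map_id[unfolded id_def] intro!: arg_cong[of _ _ "subtopology X"])
  have "right_inverse I le fixed_space (\<lambda>S T. ret S) (\<lambda>_ _ x. x)"
    unfolding right_inverse_def using emb by (auto simp: le ad ret_fixed)
  then have "r_skeleton X I le fixed_space (\<lambda>S T. ret S) ret (\<lambda>_ _ x. x)"
    unfolding r_skeleton_def using system complete limit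
    by (auto simp: I_def second_countable_fixed_space)
  moreover have "embedding_map (fixed_space S) X (\<lambda>x. x)" for S
    unfolding embedding_map_def fixed_space_def
    by (simp add: subtopology_subtopology subtopology_restrict homeomorphic_map_id[unfolded id_def])
  then have "limit_embeddings X I le fixed_space ret (\<lambda>_ _ x. x) (\<lambda>_ x. x)"
    unfolding limit_embeddings_def by (simp add: ret_fixed ad)
  ultimately have "commutative_r_skeleton X I le fixed_space (\<lambda>S T. ret S) ret (\<lambda>_ _ x. x)"
    unfolding commutative_r_skeleton_def using ret_ret(1) ad by blast
  then show ?thesis unfolding has_commutative_r_skeleton_def by blast
qed

end

section \<open>From skeletons to Valdivia embeddings\<close>

text \<open>A single monotone \<open>H\<close>, so that the hulls of the initial segments of a well-order increase.\<close>
lemma directed_hull: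
  includes cardinal_syntax
  assumes "directed_set le A"
  shows "\<exists>H. (\<forall>B. B \<subseteq> A \<longrightarrow> B \<subseteq> H B \<and> H B \<subseteq> A) \<and>
    (\<forall>B. B \<subseteq> A \<longrightarrow> B \<noteq> {} \<longrightarrow> directed_set le (H B)) \<and>
    (\<forall>B C. B \<subseteq> C \<longrightarrow> H B \<subseteq> H C) \<and>
    (\<forall>B. countable B \<longrightarrow> countable (H B)) \<and>
    (\<forall>B. infinite B \<longrightarrow> |H B| \<le>o |B| )"
proof -
  have "\<exists>u. s \<in> A \<longrightarrow> t \<in> A \<longrightarrow> u \<in> A \<and> (s, u) \<in> le \<and> (t, u) \<in> le" for s t
    using assms unfolding directed_set_def by blast
  \<comment> \<open>One choice of upper bounds is fixed for all of \<open>A\<close>; hulls of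
    different subsets use the same bounds and are therefore monotone.\<close>
  then obtain \<phi> where \<phi>: "\<And>s t. s \<in> A \<Longrightarrow> t \<in> A \<Longrightarrow> \<phi> s t \<in> A \<and> (s, \<phi> s t) \<in> le \<and> (t, \<phi> s t) \<in> le"
    by metis
  define P where "P B n = ((\<lambda>C. C \<union> (\<Union>s\<in>C. \<Union>t\<in>C. {\<phi> s t})) ^^ n) B" for B n
  define H where "H B = (\<Union>n. P B n)" for B
  have P0: "P B 0 = B" and PS: "P B (Suc n) = P B n \<union> (\<Union>s\<in>P B n. \<Union>t\<in>P B n. {\<phi> s t})" for B n
    by (simp_all add: P_def)
  have P_mono: "P B m \<subseteq> P B n" if "m \<le> n" for B m n
    using lift_Suc_mono_le[of "P B" m n] that by (simp add: PS)
  have P_sub: "P B n \<subseteq> A" if "B \<subseteq> A" for B n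
  proof (induction n)
    case (Suc n)
    then have "\<phi> s t \<in> A" if "s \<in> P B n" "t \<in> P B n" for s t using that \<phi> by blast
    with Suc show ?case by (auto simp: PS)
  qed (simp add: P0 that)
  have H_sub: "B \<subseteq> H B \<and> H B \<subseteq> A" if "B \<subseteq> A" for B
    unfolding H_def using P0[of B] P_sub[OF that] by blast
  have "directed_set le (H B)" if "B \<subseteq> A" "B \<noteq> {}" for B
    unfolding directed_set_def
  proof (intro conjI ballI)
    show "H B \<noteq> {}" using H_sub that by blast
    fix s t assume "s \<in> H B" "t \<in> H B"
    then obtain m n where mn: "s \<in> P B m" "t \<in> P B n" by (auto simp: H_def)
    then have st: "s \<in> P B (max m n)" "t \<in> P B (max m n)"
      using P_mono[of m "max m n" B] P_mono[of n "max m n" B] by auto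
    then have "\<phi> s t \<in> P B (Suc (max m n))" by (auto simp: PS)
    then have "\<phi> s t \<in> H B" unfolding H_def by blast
    moreover have "s \<in> A" "t \<in> A" using st P_sub[OF that(1)] by auto
    ultimately show "\<exists>u\<in>H B. (s, u) \<in> le \<and> (t, u) \<in> le" using \<phi> by blast
  qed
  moreover have "P B n \<subseteq> P C n" if "B \<subseteq> C" for B C n
    by (induction n) (use that in \<open>auto simp: P0 PS\<close>)
  then have "H B \<subseteq> H C" if "B \<subseteq> C" for B C
    using that unfolding H_def by (meson UN_mono order_refl)
  moreover have "countable (H B)" if "countable B" for B
  proof -
    have "countable (P B n)" for n
      by (induction n) (use that in \<open>auto simp: P0 PS\<close>)
    then show ?thesis unfolding H_def by simp
  qed
  moreover have "|H B| \<le>o |B|" if "infinite B" for B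
  proof -
    have P_card: "|P B n| \<le>o |B|" for n
    proof (induction n)
      case (Suc n)
      have "|{\<phi> s t}| \<le>o |B|" for s t
        using \<open>infinite B\<close> by (intro card_of_singl_ordLeq) auto
      then have "|\<Union>s\<in>P B n. \<Union>t\<in>P B n. {\<phi> s t}| \<le>o |B|"
        using Suc that by (intro card_of_UNION_ordLeq_infinite ballI) auto
      then show ?case
        unfolding PS using Suc that
        by (intro card_of_Un_ordLeq_infinite_Field) (simp_all add: Field_card_of card_of_card_order_on)
    qed (simp add: P0 card_of_mono1)
    have "|UNIV :: nat set| \<le>o |B|" using that infinite_iff_card_of_nat by blast
    then show ?thesis
      unfolding H_def using P_card that by (intro card_of_UNION_ordLeq_infinite) auto
  qed
  ultimately show ?thesis using H_sub by (intro exI[of _ H]) simp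
qed

section \<open>Commuting retractions on a compact space\<close>

text \<open>What remains of a commutative skeleton when each \<open>Y s\<close> is identified with
  its copy in \<open>X\<close>. The condition \<open>countable_sup\<close> is the trace of
  sigma-completeness: the retractions of a countable directed set determine that of an upper
  bound.\<close>

locale retraction_system =
  fixes X :: "'a topology" and I :: "'i set" and le :: "'i rel" and R :: "'i \<Rightarrow> 'a \<Rightarrow> 'a"
  assumes compact: "compact_space X" and Hausdorff: "Hausdorff_space X"
    and refl: "\<And>s. s \<in> I \<Longrightarrow> (s, s) \<in> le"
    and directed: "directed_set le I"
    and cont: "\<And>s. s \<in> I \<Longrightarrow> continuous_map X X (R s)"
    and absorb: "\<And>s t x. s \<in> I \<Longrightarrow> t \<in> I \<Longrightarrow> (s, t) \<in> le \<Longrightarrow> x \<in> topspace X \<Longrightarrow>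
      R s (R t x) = R s x \<and> R t (R s x) = R s x"
    and commute: "\<And>s t x. s \<in> I \<Longrightarrow> t \<in> I \<Longrightarrow> x \<in> topspace X \<Longrightarrow> R s (R t x) = R t (R s x)"
    and second_countable_image: "\<And>s. s \<in> I \<Longrightarrow> second_countable (subtopology X (R s ` topspace X))"
    and separating: "\<And>x y. x \<in> topspace X \<Longrightarrow> y \<in> topspace X \<Longrightarrow> (\<And>s. s \<in> I \<Longrightarrow> R s x = R s y) \<Longrightarrow> x = y"
    and countable_sup: "\<And>D. D \<subseteq> I \<Longrightarrow> countable D \<Longrightarrow> directed_set le D \<Longrightarrow>
      \<exists>u\<in>I. (\<forall>s\<in>D. (s, u) \<in> le) \<and>
        (\<forall>x\<in>topspace X. \<forall>y\<in>topspace X. (\<forall>s\<in>D. R s x = R s y) \<longrightarrow> R u x = R u y)"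
begin

lemma R_in: "s \<in> I \<Longrightarrow> x \<in> topspace X \<Longrightarrow> R s x \<in> topspace X"
  using continuous_map_image_subset_topspace[OF cont] by blast

lemma R_idem: "s \<in> I \<Longrightarrow> x \<in> topspace X \<Longrightarrow> R s (R s x) = R s x"
  using absorb refl by blast

definition fixed_set :: "'i \<Rightarrow> 'a set" where
  "fixed_set s = {x \<in> topspace X. R s x = x}"

lemma image_R: "s \<in> I \<Longrightarrow> R s ` topspace X = fixed_set s"
  unfolding fixed_set_def using R_in R_idem by (auto intro!: image_eqI)

lemma fixed_set_topspace: "fixed_set s \<subseteq> topspace X"
  by (auto simp: fixed_set_def)

lemma closedin_fixed_set:
  assumes "s \<in> I"
  shows "closedin X (fixed_set s)"
  unfolding fixed_set_def
  using closedin_continuous_maps_eq[OF Hausdorff cont[OF assms] continuous_map_id] by simp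

text \<open>A direct use of commutativity: applying \<open>R s\<close> to \<open>R t x\<close> can
  be moved inside, where it fixes \<open>x\<close>.\<close>

lemma R_fixed_set:
  assumes "s \<in> I" "t \<in> I" "x \<in> fixed_set s"
  shows "R t x \<in> fixed_set s"
  using assms R_in[of t x] commute[of s t x] by (simp add: fixed_set_def)

lemma fixed_set_mono: "s \<in> I \<Longrightarrow> t \<in> I \<Longrightarrow> (s, t) \<in> le \<Longrightarrow> fixed_set s \<subseteq> fixed_set t"
  unfolding fixed_set_def using absorb by force

lemma second_countable_fixed_set: "s \<in> I \<Longrightarrow> second_countable (subtopology X (fixed_set s))"
  using second_countable_image image_R by simp

text \<open>The point \<open>R s x\<close> meets the condition at \<open>s\<close>, and conditions
  at larger indices imply those at smaller ones, so compactness finds a common solution in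
  \<open>C\<close>, although \<open>x\<close> itself may lie outside \<open>C\<close>.\<close>

lemma directed_lift:
  assumes "A \<subseteq> I" "directed_set le A" "closedin X C" "x \<in> topspace X" "\<And>s. s \<in> A \<Longrightarrow> R s x \<in> C"
  shows "\<exists>y\<in>C. \<forall>s\<in>A. R s y = R s x"
proof -
  have "\<exists>y\<in>topspace X. \<forall>s\<in>A. y \<in> C \<inter> {y \<in> topspace X. R s y \<in> {R s x}}"
  proof (rule compact_space_directed_Inter[OF compact])
    show "A \<noteq> {}" using assms(2) by (simp add: directed_set_def)
    show "closedin X (C \<inter> {y \<in> topspace X. R s y \<in> {R s x}})" if "s \<in> A" for s
      using that assms(1,4) by (intro closedin_Int[OF assms(3)] closedin_continuous_map_preimage[OF cont])
        (auto simp: closedin_Hausdorff_singleton[OF Hausdorff] R_in)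
    show "C \<inter> {y \<in> topspace X. R s y \<in> {R s x}} \<noteq> {}" if "s \<in> A" for s
    proof -
      have "s \<in> I" using that assms(1) by auto
      then have "R s x \<in> C \<inter> {y \<in> topspace X. R s y \<in> {R s x}}"
        using assms(5)[OF that] R_in R_idem assms(4) by simp
      then show ?thesis by blast
    qed
    fix s t assume st: "s \<in> A" "t \<in> A"
    then obtain u where u: "u \<in> A" "(s, u) \<in> le" "(t, u) \<in> le"
      using assms(2) unfolding directed_set_def by blast
    have "R v y = R v x" if "v \<in> A" "(v, u) \<in> le" "y \<in> topspace X" "R u y = R u x" for v y
    proof -
      have "v \<in> I" "u \<in> I" using that u assms(1) by auto
      then show ?thesis
        using absorb[of v u y] absorb[of v u x] that(2-4) assms(4) by simp
    qed
    then show "\<exists>u\<in>A. C \<inter> {y \<in> topspace X. R u y \<in> {R u x}} \<subseteq>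
        (C \<inter> {y \<in> topspace X. R s y \<in> {R s x}}) \<inter> (C \<inter> {y \<in> topspace X. R t y \<in> {R t x}})"
      using st u by (intro bexI[of _ u]) auto
  qed
  then obtain y where y: "\<forall>s\<in>A. y \<in> C \<inter> {y \<in> topspace X. R s y \<in> {R s x}}" by blast
  moreover have "A \<noteq> {}" using assms(2) by (simp add: directed_set_def)
  ultimately show ?thesis by (intro bexI[of _ y]) auto
qed

text \<open>A lift of the values \<open>R s x\<close> into the closure can only be \<open>x\<close>,
  because the retractions separate points. At the points of the fixed sets only countably many
  coordinates will be nonzero, so this becomes the density of the Sigma-part.\<close>

lemma fixed_set_dense: "X closure_of (\<Union>s\<in>I. fixed_set s) = topspace X"
proof -
  let ?C = "X closure_of (\<Union>s\<in>I. fixed_set s)"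
  have sub: "(\<Union>s\<in>I. fixed_set s) \<subseteq> ?C"
    using fixed_set_topspace by (intro closure_of_subset) auto
  have "x \<in> ?C" if x: "x \<in> topspace X" for x
  proof -
    have "R s x \<in> ?C" if "s \<in> I" for s
      using sub image_R[OF that] that x by blast
    then obtain y where y: "y \<in> ?C" "\<forall>s\<in>I. R s y = R s x"
      using directed_lift[OF subset_refl directed closedin_closure_of x, of "\<Union>s\<in>I. fixed_set s"] by blast
    then have "y = x" using separating[of y x] x by (simp add: in_closure_of)
    then show ?thesis using y(1) by simp
  qed
  then show ?thesis using closure_of_subset_topspace by fast
qed

section \<open>Projections along directed sets of indices\<close>

definition limit_set :: "'i set \<Rightarrow> 'a set" where
  "limit_set A = X closure_of (\<Union>s\<in>A. fixed_set s)"

lemma closedin_limit_set: "closedin X (limit_set A)"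
  by (simp add: limit_set_def)

lemma limit_set_topspace: "limit_set A \<subseteq> topspace X"
  by (simp add: limit_set_def closure_of_subset_topspace)

lemma limit_set_mono: "A \<subseteq> B \<Longrightarrow> limit_set A \<subseteq> limit_set B"
  unfolding limit_set_def by (intro closure_of_mono) auto

lemma fixed_set_limit_set: "s \<in> A \<Longrightarrow> fixed_set s \<subseteq> limit_set A"
  unfolding limit_set_def
  using closure_of_subset[of "\<Union>s\<in>A. fixed_set s" X] fixed_set_topspace by blast

lemma limit_set_image_subset:
  assumes "t \<in> I" "closedin X C" "\<And>s x. s \<in> A \<Longrightarrow> x \<in> fixed_set s \<Longrightarrow> R t x \<in> C" "x \<in> limit_set A"
  shows "R t x \<in> C"
proof -
  have "limit_set A \<subseteq> {x \<in> topspace X. R t x \<in> C}"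
    unfolding limit_set_def
  proof (rule closure_of_minimal)
    show "(\<Union>s\<in>A. fixed_set s) \<subseteq> {x \<in> topspace X. R t x \<in> C}"
      using assms(3) fixed_set_topspace by auto
  qed (rule closedin_continuous_map_preimage[OF cont[OF assms(1)] assms(2)])
  then show ?thesis using assms(4) by auto
qed

lemma R_limit_set:
  assumes "A \<subseteq> I" "t \<in> I" "x \<in> limit_set A"
  shows "R t x \<in> limit_set A"
proof (rule limit_set_image_subset[OF assms(2) closedin_limit_set _ assms(3)])
  show "R t x \<in> limit_set A" if "s \<in> A" "x \<in> fixed_set s" for s x
    using R_fixed_set[OF _ assms(2) that(2)] assms(1) that(1) fixed_set_limit_set by blast
qed

text \<open>On the fixed sets of \<open>A\<close>, \<open>R t\<close> takes values in
  \<open>?E\<close>, part of the second countable image of \<open>R t\<close>. A countable dense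
  subset of \<open>?E\<close> involves countably many indices of \<open>A\<close>; an upper bound
  \<open>u\<close> of their hull \<open>D\<close> fixes that subset and, by closedness, all of
  \<open>?E\<close>. Since \<open>u\<close> may lie outside \<open>A\<close>, the link back to
  \<open>A\<close> is that \<open>D\<close> determines \<open>R u\<close>.\<close>

lemma limit_set_fixed_set_countable:
  assumes "A \<subseteq> I" "directed_set le A" "t \<in> I"
  shows "\<exists>D u. D \<subseteq> A \<and> u \<in> I \<and> (\<forall>x\<in>limit_set A. R t x \<in> fixed_set u) \<and>
    (\<forall>x\<in>topspace X. \<forall>y\<in>topspace X. (\<forall>s\<in>D. R s x = R s y) \<longrightarrow> R u x = R u y)"
proof -
  let ?E = "\<Union>s\<in>A. fixed_set s \<inter> fixed_set t"
  have E: "?E \<subseteq> topspace (subtopology X (fixed_set t))" using fixed_set_topspace by auto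
  obtain W where W: "countable W" "W \<subseteq> ?E" "?E \<subseteq> subtopology X (fixed_set t) closure_of W"
    by (rule second_countable_dense_subset[OF second_countable_fixed_set[OF assms(3)] E])
  have "\<exists>s\<in>A. w \<in> fixed_set s" if "w \<in> W" for w using that W(2) by blast
  then obtain \<sigma> where \<sigma>: "\<And>w. w \<in> W \<Longrightarrow> \<sigma> w \<in> A \<and> w \<in> fixed_set (\<sigma> w)" by metis
  obtain a where "a \<in> A" using assms(2) by (auto simp: directed_set_def)
  \<comment> \<open>The index \<open>a\<close> keeps this set nonempty when \<open>W\<close> is
    empty, so that its hull is directed.\<close>
  let ?B = "insert a (\<sigma> ` W)"
  have B: "?B \<subseteq> A" "?B \<noteq> {}" "countable ?B" using \<sigma> \<open>a \<in> A\<close> W(1) by auto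
  obtain H where H: "?B \<subseteq> H ?B" "H ?B \<subseteq> A" "directed_set le (H ?B)" "countable (H ?B)"
    using directed_hull[OF assms(2)] B by meson
  let ?D = "H ?B"
  have DI: "?D \<subseteq> I" using H(2) assms(1) by blast
  obtain u where u: "u \<in> I" "\<forall>s\<in>?D. (s, u) \<in> le"
    "\<forall>x\<in>topspace X. \<forall>y\<in>topspace X. (\<forall>s\<in>?D. R s x = R s y) \<longrightarrow> R u x = R u y"
    using countable_sup[OF DI H(4,3)] by auto
  have "W \<subseteq> fixed_set u"
  proof
    fix w assume "w \<in> W"
    then have "\<sigma> w \<in> ?D" "w \<in> fixed_set (\<sigma> w)" using \<sigma> H(1) by auto
    then show "w \<in> fixed_set u" using fixed_set_mono[of "\<sigma> w" u] u DI by auto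
  qed
  then have "X closure_of W \<subseteq> fixed_set u"
    by (rule closure_of_minimal[OF _ closedin_fixed_set[OF u(1)]])
  then have Eu: "?E \<subseteq> fixed_set u"
    using W(3) closure_of_subtopology_subset[of X "fixed_set t" W] by blast
  have "\<forall>x\<in>limit_set A. R t x \<in> fixed_set u"
  proof (rule ballI, rule limit_set_image_subset[OF assms(3) closedin_fixed_set[OF u(1)]])
    fix s x assume s: "s \<in> A" "x \<in> fixed_set s"
    then have "s \<in> I" using assms(1) by auto
    then have "R t x \<in> fixed_set s" using R_fixed_set assms(3) s by blast
    moreover have "R t x \<in> fixed_set t"
      using s(2) fixed_set_topspace image_R[OF assms(3)] by blast
    ultimately show "R t x \<in> fixed_set u" using Eu s(1) by blast
  qed
  then show ?thesis
    by (intro exI[of _ ?D] exI[of _ u] conjI H(2) u(1,3))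
qed

text \<open>For every \<open>t\<close> the points \<open>R t x\<close> and \<open>R t y\<close> are
  fixed by a common \<open>R u\<close>. Commutativity shows that the \<open>R s\<close> with
  \<open>s\<close> in \<open>D\<close> agree on them, so \<open>R u\<close> does too, and they
  coincide.\<close>

lemma limit_set_eqI:
  assumes A: "A \<subseteq> I" "directed_set le A" and xy: "x \<in> limit_set A" "y \<in> limit_set A"
    and eq: "\<And>s. s \<in> A \<Longrightarrow> R s x = R s y"
  shows "x = y"
proof (rule separating)
  show X: "x \<in> topspace X" "y \<in> topspace X" using xy limit_set_topspace by auto
  fix t assume t: "t \<in> I"
  obtain D u where D: "D \<subseteq> A" "u \<in> I" "\<forall>x\<in>limit_set A. R t x \<in> fixed_set u"
    "\<forall>x\<in>topspace X. \<forall>y\<in>topspace X. (\<forall>s\<in>D. R s x = R s y) \<longrightarrow> R u x = R u y"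
    using limit_set_fixed_set_countable[OF A t] by (elim exE conjE)
  have "R s (R t x) = R s (R t y)" if "s \<in> D" for s
  proof -
    have "s \<in> A" "s \<in> I" using that D(1) A(1) by auto
    then show ?thesis using commute[OF _ t X(1), of s] commute[OF _ t X(2), of s] eq by simp
  qed
  then have "R u (R t x) = R u (R t y)" using D(4) R_in[OF t] X by blast
  then show "R t x = R t y" using D(3) xy by (auto simp: fixed_set_def)
qed

text \<open>For directed \<open>A\<close> and \<open>x\<close> in \<open>X\<close> the point exists
  by \<open>directed_lift\<close> and is unique by \<open>limit_set_eqI\<close>. Equations for it
  are proved by exhibiting another candidate.\<close>

definition proj :: "'i set \<Rightarrow> 'a \<Rightarrow> 'a" where
  "proj A x = (SOME y. y \<in> limit_set A \<and> (\<forall>s\<in>A. R s y = R s x))"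

lemma proj:
  assumes "A \<subseteq> I" "directed_set le A" "x \<in> topspace X"
  shows proj_limit_set: "proj A x \<in> limit_set A" and R_proj: "\<And>s. s \<in> A \<Longrightarrow> R s (proj A x) = R s x"
proof -
  have "R s x \<in> limit_set A" if "s \<in> A" for s
    using fixed_set_limit_set[OF that] image_R assms(1,3) that by blast
  then have "\<exists>y. y \<in> limit_set A \<and> (\<forall>s\<in>A. R s y = R s x)"
    using directed_lift[OF assms(1,2) closedin_limit_set assms(3)] by blast
  from someI_ex[OF this] show "proj A x \<in> limit_set A" and "\<And>s. s \<in> A \<Longrightarrow> R s (proj A x) = R s x"
    unfolding proj_def by simp_all
qed

lemma proj_topspace: "A \<subseteq> I \<Longrightarrow> directed_set le A \<Longrightarrow> x \<in> topspace X \<Longrightarrow> proj A x \<in> topspace X"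
  using proj_limit_set limit_set_topspace by blast

lemma proj_eqI:
  assumes "A \<subseteq> I" "directed_set le A" "x \<in> topspace X" "y \<in> limit_set A" "\<And>s. s \<in> A \<Longrightarrow> R s y = R s x"
  shows "proj A x = y"
proof (rule limit_set_eqI[OF assms(1,2) proj_limit_set[OF assms(1-3)] assms(4)])
  show "R s (proj A x) = R s y" if "s \<in> A" for s
    using R_proj[OF assms(1-3) that] assms(5)[OF that] by simp
qed

text \<open>On the compact limit set the retractions indexed by \<open>A\<close> are jointly
  injective, so \<open>proj A\<close> is the lift of their joint map on \<open>X\<close>.\<close>

lemma continuous_map_proj:
  assumes "A \<subseteq> I" "directed_set le A"
  shows "continuous_map X X (proj A)"
proof -
  let ?g = "\<lambda>x. \<lambda>s\<in>A. R s x"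
  have g: "continuous_map X (product_topology (\<lambda>_. X) A) ?g"
    using cont assms(1) by (auto simp: continuous_map_componentwise)
  have "continuous_map X (subtopology X (limit_set A)) (proj A)"
  proof (rule continuous_map_lift_injective[where P = "product_topology (\<lambda>_. X) A" and g = ?g and q = ?g])
    show "compact_space (subtopology X (limit_set A))"
      by (intro compact_space_subtopology closedin_compact_space[OF compact] closedin_limit_set)
    show "Hausdorff_space (product_topology (\<lambda>_. X) A)"
      by (simp add: Hausdorff_space_product_topology Hausdorff)
    show "continuous_map (subtopology X (limit_set A)) (product_topology (\<lambda>_. X) A) ?g"
      by (rule continuous_map_from_subtopology[OF g])
    show "inj_on ?g (topspace (subtopology X (limit_set A)))"
    proof (rule inj_onI)
      fix x y assume xy: "x \<in> topspace (subtopology X (limit_set A))" "y \<in> topspace (subtopology X (limit_set A))"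
        and eq: "?g x = ?g y"
      show "x = y"
      proof (rule limit_set_eqI[OF assms])
        show "R s x = R s y" if "s \<in> A" for s using fun_cong[OF eq, of s] that by simp
      qed (use xy in simp_all)
    qed
    show "proj A x \<in> topspace (subtopology X (limit_set A)) \<and> ?g (proj A x) = ?g x" if "x \<in> topspace X" for x
      using proj_topspace[OF assms that] proj_limit_set[OF assms that] R_proj[OF assms that] by auto
  qed (rule g)
  then show ?thesis by (simp add: continuous_map_in_subtopology)
qed

text \<open>By commutativity \<open>R t (proj A x)\<close> is another candidate for the projection
  of \<open>x\<close>. This confines the later counting argument to one second countable
  space.\<close>

lemma proj_fixed_set:
  assumes "A \<subseteq> I" "directed_set le A" "t \<in> I" "x \<in> fixed_set t"
  shows "proj A x \<in> fixed_set t"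
proof -
  have x: "x \<in> topspace X" "R t x = x" using assms(4) by (auto simp: fixed_set_def)
  note y = proj_limit_set[OF assms(1,2) x(1)] R_proj[OF assms(1,2) x(1)] proj_topspace[OF assms(1,2) x(1)]
  have "proj A x = R t (proj A x)"
  proof (rule proj_eqI[OF assms(1,2) x(1)])
    show "R t (proj A x) \<in> limit_set A" by (rule R_limit_set[OF assms(1,3) y(1)])
    show "R s (R t (proj A x)) = R s x" if "s \<in> A" for s
    proof -
      have "s \<in> I" using that assms(1) by auto
      then show ?thesis
        using commute[OF _ assms(3) y(3), of s] commute[OF _ assms(3) x(1), of s] y(2)[OF that] x(2) by simp
    qed
  qed
  then show ?thesis using y(3) by (simp add: fixed_set_def)
qed

section \<open>Coordinate functions by induction on cardinality\<close>

text \<open>The equivalence matters in both directions: one gives separation, the other says that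
  each function depends only on the retractions along \<open>A\<close>, so it is unchanged by
  \<open>proj A\<close> when \<open>A\<close> is directed. Countability is asked on the fixed sets
  of all \<open>t\<close> in \<open>I\<close>, not just of those in \<open>A\<close>, as these make
  up the dense set needed at the end.\<close>

definition coordinates :: "'i set \<Rightarrow> ('a \<Rightarrow> real) set \<Rightarrow> bool" where
  "coordinates A G \<longleftrightarrow>
     (\<forall>f\<in>G. continuous_map X (top_of_set {0..1}) f) \<and>
     (\<forall>x\<in>topspace X. \<forall>y\<in>topspace X. (\<forall>f\<in>G. f x = f y) \<longleftrightarrow> (\<forall>s\<in>A. R s x = R s y)) \<and>
     (\<forall>t\<in>I. \<forall>x\<in>fixed_set t. countable {f \<in> G. f x \<noteq> 0})"

text \<open>A supremum \<open>u\<close> carries the same information as \<open>A\<close>, so a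
  countable separating family on the compact second countable image of \<open>R u\<close> can be
  pulled back along \<open>R u\<close>.\<close>

lemma coordinates_countable:
  assumes "A \<subseteq> I" "directed_set le A" "countable A"
  shows "\<exists>G. coordinates A G"
proof -
  obtain u where u: "u \<in> I" "\<forall>s\<in>A. (s, u) \<in> le"
    "\<forall>x\<in>topspace X. \<forall>y\<in>topspace X. (\<forall>s\<in>A. R s x = R s y) \<longrightarrow> R u x = R u y"
    using countable_sup[OF assms(1,3,2)] by (elim bexE conjE)
  let ?Z = "subtopology X (fixed_set u)"
  have Z: "topspace ?Z = fixed_set u" using fixed_set_topspace[of u] by auto
  have "compact_space ?Z"
    by (intro compact_space_subtopology closedin_compact_space[OF compact] closedin_fixed_set u(1))
  moreover have "Hausdorff_space ?Z" by (rule Hausdorff_space_subtopology[OF Hausdorff])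
  ultimately obtain F0 :: "('a \<Rightarrow> real) set" where F0: "countable F0"
    "\<And>f. f \<in> F0 \<Longrightarrow> continuous_map ?Z (top_of_set {0..1}) f"
    "\<And>x y. x \<in> topspace ?Z \<Longrightarrow> y \<in> topspace ?Z \<Longrightarrow> (\<And>f. f \<in> F0 \<Longrightarrow> f x = f y) \<Longrightarrow> x = y"
    using countable_separating_family[OF _ _ second_countable_fixed_set[OF u(1)]] by metis
  have Ru: "R u x \<in> topspace ?Z" if "x \<in> topspace X" for x
    using image_R[OF u(1)] that Z by blast
  have "continuous_map X ?Z (R u)"
    using cont[OF u(1)] Ru by (auto simp: continuous_map_in_subtopology)
  then have "\<forall>g\<in>(\<lambda>f. f \<circ> R u) ` F0. continuous_map X (top_of_set {0..1}) g"
    using F0(2) by (auto intro: continuous_map_compose)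
  moreover have "(\<forall>g\<in>(\<lambda>f. f \<circ> R u) ` F0. g x = g y) \<longleftrightarrow> (\<forall>s\<in>A. R s x = R s y)"
    if xy: "x \<in> topspace X" "y \<in> topspace X" for x y
  proof
    assume "\<forall>g\<in>(\<lambda>f. f \<circ> R u) ` F0. g x = g y"
    then have "f (R u x) = f (R u y)" if "f \<in> F0" for f using that by (auto dest: bspec[of _ _ "f \<circ> R u"])
    then have eq: "R u x = R u y" using F0(3)[OF Ru[OF xy(1)] Ru[OF xy(2)]] by simp
    show "\<forall>s\<in>A. R s x = R s y"
    proof
      fix s assume "s \<in> A"
      then have "s \<in> I" "(s, u) \<in> le" using assms(1) u(2) by auto
      then show "R s x = R s y"
        using absorb[OF _ u(1) _ xy(1), of s] absorb[OF _ u(1) _ xy(2), of s] eq by simp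
    qed
  next
    assume "\<forall>s\<in>A. R s x = R s y"
    then have "R u x = R u y" using u(3) xy by blast
    then show "\<forall>g\<in>(\<lambda>f. f \<circ> R u) ` F0. g x = g y" by simp
  qed
  moreover have "countable {f \<in> (\<lambda>f. f \<circ> R u) ` F0. f x \<noteq> 0}" for x
    using F0(1) by simp
  ultimately have "coordinates A ((\<lambda>f. f \<circ> R u) ` F0)"
    unfolding coordinates_def by simp
  then show ?thesis ..
qed

text \<open>For \<open>x\<close> in the image of some \<open>R t\<close>, the points \<open>proj (M a) x\<close> outside \<open>limit_set (L a)\<close> are
  separated by a strictly increasing chain of closed subsets of a second countable space, so there are
  only countably many of them.\<close>
lemma coordinates_chain:
  assumes A: "A \<subseteq> I"
    and wf: "wf r" and total: "\<And>a b. a \<in> A \<Longrightarrow> b \<in> A \<Longrightarrow> a \<noteq> b \<Longrightarrow> (a, b) \<in> r \<or> (b, a) \<in> r"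
    and field: "\<And>a b. (a, b) \<in> r \<Longrightarrow> a \<in> A \<and> b \<in> A"
    and M: "\<And>a. a \<in> A \<Longrightarrow> a \<in> M a \<and> M a \<subseteq> A \<and> directed_set le (M a)"
    and mono: "\<And>a b. (b, a) \<in> r \<Longrightarrow> M b \<subseteq> M a"
    and G: "\<And>a. a \<in> A \<Longrightarrow> coordinates (M a) (G a)"
  shows "\<exists>G. coordinates A G"
proof -
  define L where "L a = (\<Union>b\<in>{b. (b, a) \<in> r}. M b)" for a
  \<comment> \<open>Directed sets are nonempty, so there is no projection along an empty
    \<open>L a\<close>; with the value 0 the function \<open>f\<close> itself is kept at such a
    stage.\<close>
  define k where "k a f x = (if L a = {} then 0 else f (proj (L a) x))" for a and f :: "'a \<Rightarrow> real" and x
  \<comment> \<open>The difference may be negative, while coordinates must lie in the unit interval.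
    The two parts do and together determine the difference.\<close>
  define pos where "pos a f = (\<lambda>x. max 0 (f x - k a f x))" for a f
  define neg where "neg a f = (\<lambda>x. max 0 (k a f x - f x))" for a f
  define N where "N = (\<Union>a\<in>A. \<Union>f\<in>G a. {pos a f, neg a f})"
  have MI: "M a \<subseteq> I" "directed_set le (M a)" if "a \<in> A" for a
    using M[OF that] A by auto
  have LM: "L a \<subseteq> M a" for a using mono by (auto simp: L_def)
  have LI: "L a \<subseteq> I" if "a \<in> A" for a
    using LM MI that by blast
  have Ldir: "directed_set le (L a)" if "L a \<noteq> {}" for a
    unfolding directed_set_def
  proof (intro conjI ballI that)
    fix s t assume "s \<in> L a" "t \<in> L a"
    then obtain b c where bc: "(b, a) \<in> r" "(c, a) \<in> r" "s \<in> M b" "t \<in> M c" by (auto simp: L_def)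
    have "b \<in> A" "c \<in> A" using field bc by auto
    then have "M b \<subseteq> M c \<or> M c \<subseteq> M b" using total[of b c] mono by blast
    then obtain d where d: "(d, a) \<in> r" "s \<in> M d" "t \<in> M d" using bc by blast
    then have "directed_set le (M d)" using field M by blast
    then obtain u where "u \<in> M d" "(s, u) \<in> le" "(t, u) \<in> le"
      using d unfolding directed_set_def by blast
    then show "\<exists>u\<in>L a. (s, u) \<in> le \<and> (t, u) \<in> le" using d(1) by (auto simp: L_def)
  qed
  have Gc: "continuous_map X (top_of_set {0..1}) f" if "a \<in> A" "f \<in> G a" for a f
    using G[OF that(1)] that(2) by (simp add: coordinates_def)
  have Gk: "(\<forall>f\<in>G a. f x = f y) \<longleftrightarrow> (\<forall>s\<in>M a. R s x = R s y)"
    if "a \<in> A" "x \<in> topspace X" "y \<in> topspace X" for a x y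
    using G[OF that(1)] that(2,3) by (simp add: coordinates_def)
  have Gn: "countable {f \<in> G a. f x \<noteq> 0}" if "a \<in> A" "t \<in> I" "x \<in> fixed_set t" for a t x
    using G[OF that(1)] that(2,3) by (simp add: coordinates_def)
  have kc: "continuous_map X (top_of_set {0..1}) (k a f)" if a: "a \<in> A" "f \<in> G a" for a f
  proof (cases "L a = {}")
    case True
    then have "k a f = (\<lambda>_. 0)" by (auto simp: k_def)
    then show ?thesis by simp
  next
    case False
    then have "k a f = f \<circ> proj (L a)" by (simp add: k_def fun_eq_iff)
    then show ?thesis
      using continuous_map_compose[OF continuous_map_proj[OF LI[OF a(1)] Ldir[OF False]] Gc[OF a]] by simp
  qed
  have "continuous_map X (top_of_set {0..1}) g" if "g \<in> N" for g
  proof -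
    obtain a f where a: "a \<in> A" "f \<in> G a" and g: "g = pos a f \<or> g = neg a f"
      using \<open>g \<in> N\<close> by (auto simp: N_def)
    have f: "continuous_map X euclideanreal f" "\<And>x. x \<in> topspace X \<Longrightarrow> f x \<in> {0..1}"
      using Gc[OF a] by (auto simp: continuous_map_in_subtopology)
    have kf: "continuous_map X euclideanreal (k a f)" "\<And>x. x \<in> topspace X \<Longrightarrow> k a f x \<in> {0..1}"
      using kc[OF a] by (auto simp: continuous_map_in_subtopology)
    have "continuous_map X euclideanreal (pos a f)" "continuous_map X euclideanreal (neg a f)"
      unfolding pos_def neg_def
      by (intro continuous_map_real_max continuous_map_diff f(1) kf(1) continuous_map_const[THEN iffD2]; simp)+
    moreover have "pos a f x \<in> {0..1}" "neg a f x \<in> {0..1}" if "x \<in> topspace X" for x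
      using f(2)[OF that] kf(2)[OF that] by (auto simp: pos_def neg_def)
    ultimately show ?thesis
      using g by (auto simp: continuous_map_in_subtopology)
  qed
  moreover have "(\<forall>g\<in>N. g x = g y) \<longleftrightarrow> (\<forall>s\<in>A. R s x = R s y)"
    if xy: "x \<in> topspace X" "y \<in> topspace X" for x y
  proof -
    have k_eq: "k a f x = k a f y" if a: "a \<in> A" and eq: "\<forall>s\<in>L a. R s x = R s y" for a f
    proof (cases "L a = {}")
      case False
      note L = LI[OF a] Ldir[OF False]
      have "proj (L a) x = proj (L a) y"
      proof (rule proj_eqI[OF L xy(1) proj_limit_set[OF L xy(2)]])
        show "R s (proj (L a) y) = R s x" if "s \<in> L a" for s
          using R_proj[OF L xy(2) that] bspec[OF eq that] by simp
      qed
      then show ?thesis by (simp add: k_def)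
    qed (simp add: k_def)
    show ?thesis
    proof
      assume N_eq: "\<forall>g\<in>N. g x = g y"
      \<comment> \<open>Agreement at all earlier stages makes the subtracted values equal; the
        positive and negative parts then give back \<open>f x = f y\<close>.\<close>
      have "a \<in> A \<longrightarrow> (\<forall>s\<in>M a. R s x = R s y)" for a
        using wf
      proof (induction a)
        case (less a)
        show ?case
        proof
          assume a: "a \<in> A"
          have "\<forall>s\<in>L a. R s x = R s y"
            using less.IH field by (auto simp: L_def)
          then have keq: "k a f x = k a f y" for f by (rule k_eq[OF a])
          have "f x = f y" if "f \<in> G a" for f
          proof -
            have "pos a f \<in> N" "neg a f \<in> N" using that a by (auto simp: N_def)
            then have "pos a f x = pos a f y" "neg a f x = neg a f y" using N_eq by auto
            then show ?thesis using keq[of f] by (simp add: pos_def neg_def max_def split: if_splits)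
          qed
          then show "\<forall>s\<in>M a. R s x = R s y" using Gk[OF a xy] by simp
        qed
      qed
      then show "\<forall>s\<in>A. R s x = R s y" using M by blast
    next
      assume eq: "\<forall>s\<in>A. R s x = R s y"
      show "\<forall>g\<in>N. g x = g y"
      proof
        fix g assume "g \<in> N"
        then obtain a f where a: "a \<in> A" "f \<in> G a" and g: "g = pos a f \<or> g = neg a f"
          by (auto simp: N_def)
        have "\<forall>s\<in>M a. R s x = R s y" using eq M[OF a(1)] by blast
        then have "f x = f y" and "\<forall>s\<in>L a. R s x = R s y" using Gk[OF a(1) xy] a(2) LM by blast+
        then show "g x = g y" using g k_eq[OF a(1)] by (auto simp: pos_def neg_def)
      qed
    qed
  qed
  moreover have "countable {g \<in> N. g x \<noteq> 0}" if t: "t \<in> I" and x: "x \<in> fixed_set t" for t x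
  proof -
    have xX: "x \<in> topspace X" using x fixed_set_topspace by blast
    \<comment> \<open>The stages at which the projection of \<open>x\<close> changes, together with
      those having no earlier stage. At any other stage \<open>f x\<close> equals the subtracted
      value.\<close>
    define J where "J = {a \<in> A. L a = {} \<or> proj (L a) x \<noteq> proj (M a) x}"
    define C where "C a = (if L a = {} then {} else fixed_set t \<inter> limit_set (L a))" for a
    have "countable J"
    proof (rule countable_strict_closed_chain[OF second_countable_fixed_set[OF t], of _ C "\<lambda>a. proj (M a) x"])
      show "closedin (subtopology X (fixed_set t)) (C a)" if "a \<in> J" for a
        using closedin_limit_set by (auto simp: C_def closedin_subtopology)
      show "proj (M a) x \<in> topspace (subtopology X (fixed_set t)) - C a" if "a \<in> J" for a
      proof -
        have a: "a \<in> A" using that by (simp add: J_def)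
        have "proj (M a) x \<in> fixed_set t" by (rule proj_fixed_set[OF MI[OF a] t x])
        moreover have "proj (M a) x \<notin> limit_set (L a)" if ne: "L a \<noteq> {}"
        proof
          assume "proj (M a) x \<in> limit_set (L a)"
          then have "proj (L a) x = proj (M a) x"
          proof (rule proj_eqI[OF LI[OF a] Ldir[OF ne] xX])
            show "R s (proj (M a) x) = R s x" if "s \<in> L a" for s
              using R_proj[OF MI[OF a] xX] that LM by blast
          qed
          then show False using \<open>a \<in> J\<close> ne by (simp add: J_def)
        qed
        ultimately show ?thesis using fixed_set_topspace by (auto simp: C_def)
      qed
      \<comment> \<open>A projection from an earlier stage already lies in \<open>C a\<close>, while
        the one at a stage in \<open>J\<close> lies outside its own \<open>C a\<close>; this is the
        strictness of the chain.\<close>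
      have *: "proj (M b) x \<in> C a" if "a \<in> A" "b \<in> A" "(b, a) \<in> r" for a b
      proof -
        have "M b \<subseteq> L a" using that(3) by (auto simp: L_def)
        moreover have "b \<in> M b" using M[OF that(2)] by blast
        ultimately have "L a \<noteq> {}" "proj (M b) x \<in> limit_set (L a)"
          using proj_limit_set[OF MI[OF that(2)] xX] limit_set_mono by blast+
        then show ?thesis using proj_fixed_set[OF MI[OF that(2)] t x] by (simp add: C_def)
      qed
      show "proj (M a) x \<in> C b \<or> proj (M b) x \<in> C a" if "a \<in> J" "b \<in> J" "a \<noteq> b" for a b
        using total[of a b] * that by (auto simp: J_def)
    qed
    have J_zero: "pos a f x = 0 \<and> neg a f x = 0" if "a \<in> A" "a \<notin> J" "f \<in> G a" for a f
    proof -
      have La: "L a \<noteq> {}" "proj (L a) x = proj (M a) x" using that by (auto simp: J_def)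
      have "\<forall>s\<in>M a. R s (proj (M a) x) = R s x" using R_proj[OF MI[OF that(1)] xX] by simp
      then have "f (proj (M a) x) = f x"
        using Gk[OF that(1) proj_topspace[OF MI[OF that(1)] xX] xX] that(3) by blast
      then show ?thesis using La by (simp add: pos_def neg_def k_def)
    qed
    \<comment> \<open>A nonzero difference needs \<open>f\<close> to be nonzero at \<open>x\<close>
      or at its projection along \<open>L a\<close>. Both points lie in the fixed set of
      \<open>t\<close>, so either case concerns countably many \<open>f\<close>.\<close>
    define S where "S a = {f \<in> G a. f x \<noteq> 0} \<union> {f \<in> G a. k a f x \<noteq> 0}" for a
    have "countable (S a)" if a: "a \<in> A" for a
    proof -
      have "countable {f \<in> G a. k a f x \<noteq> 0}"
      proof (cases "L a = {}")
        case False
        then have "{f \<in> G a. k a f x \<noteq> 0} = {f \<in> G a. f (proj (L a) x) \<noteq> 0}" by (simp add: k_def)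
        then show ?thesis
          using Gn[OF a t proj_fixed_set[OF LI[OF a] Ldir[OF False] t x]] by simp
      qed (simp add: k_def)
      then show ?thesis unfolding S_def using Gn[OF a t x] by simp
    qed
    then have "countable (\<Union>a\<in>J. \<Union>f\<in>S a. {pos a f, neg a f})"
      using \<open>countable J\<close> by (intro countable_UN) (auto simp: J_def)
    moreover have "{g \<in> N. g x \<noteq> 0} \<subseteq> (\<Union>a\<in>J. \<Union>f\<in>S a. {pos a f, neg a f})"
    proof
      fix g assume g: "g \<in> {g \<in> N. g x \<noteq> 0}"
      then obtain a f where a: "a \<in> A" "f \<in> G a" and gf: "g = pos a f \<or> g = neg a f"
        by (auto simp: N_def)
      have "a \<in> J" using J_zero[OF a(1) _ a(2)] g gf by auto
      moreover have "f \<in> S a"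
        using g gf a(2) by (auto simp: S_def pos_def neg_def)
      ultimately show "g \<in> (\<Union>a\<in>J. \<Union>f\<in>S a. {pos a f, neg a f})" using gf by blast
    qed
    ultimately show ?thesis by (rule countable_subset[rotated])
  qed
  ultimately have "coordinates A N" unfolding coordinates_def by simp
  then show ?thesis ..
qed

text \<open>The cardinal \<open>|A|\<close> is a well-order of \<open>A\<close> whose proper initial
  segments have smaller cardinality. Their directed hulls stay smaller when \<open>A\<close> is
  uncountable, so the induction hypothesis applies to them and the chain lemma combines the
  results.\<close>

lemma coordinates_exist:
  includes cardinal_syntax
  assumes "A \<subseteq> I" "directed_set le A"
  shows "\<exists>G. coordinates A G"
  using wf_inv_image[OF wf_ordLess, of card_of] assms
proof (induction A)
  case (less A)
  show ?case
  proof (cases "countable A")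
    case True
    then show ?thesis by (rule coordinates_countable[OF less.prems])
  next
    case False
    then have inf: "infinite A" using countable_finite by blast
    define r where "r = |A| - Id"
    have wo: "well_order_on A |A|" by (rule card_of_well_order_on)
    then have part: "partial_order_on A |A|" and tot: "total_on A |A|" and wf: "wf r"
      by (auto simp: well_order_on_def linear_order_on_def r_def)
    have sub: "|A| \<subseteq> A \<times> A" and tr: "trans |A|" and anti: "antisym |A|"
      using partial_order_onD[OF part] by auto
    obtain H where H: "\<And>B. B \<subseteq> A \<Longrightarrow> B \<subseteq> H B \<and> H B \<subseteq> A"
      "\<And>B. B \<subseteq> A \<Longrightarrow> B \<noteq> {} \<Longrightarrow> directed_set le (H B)"
      "\<And>B C. B \<subseteq> C \<Longrightarrow> H B \<subseteq> H C"
      "\<And>B. countable B \<Longrightarrow> countable (H B)"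
      "\<And>B. infinite B \<Longrightarrow> |H B| \<le>o |B|"
      using directed_hull[OF less.prems(2)] by metis
    \<comment> \<open>Adding \<open>a\<close> to its segment keeps the set nonempty and makes the
      hulls cover \<open>A\<close>.\<close>
    define B where "B a = insert a (underS |A| a)" for a
    have BA: "B a \<subseteq> A" if "a \<in> A" for a
      using that sub by (auto simp: B_def underS_def)
    have "|H (B a)| <o |A|" if a: "a \<in> A" for a
    \<comment> \<open>The hull of a finite set can be countably infinite, which is still smaller
      than the uncountable \<open>A\<close>; this is why the base case covers all countable
      sets.\<close>
    proof (cases "finite (B a)")
      case True
      then have "countable (H (B a))" using H(4) countable_finite by blast
      then have "\<not> |A| \<le>o |H (B a)|"
        using False unfolding card_of_ordLeq[symmetric]
        by (metis countable_image_inj_on countable_subset)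
      then show ?thesis by (simp add: not_ordLeq_iff_ordLess card_of_Well_order)
    next
      case False
      have "|underS |A| a| <o |A|"
        by (rule card_of_underS[OF card_of_Card_order]) (simp add: a Field_card_of)
      moreover have "|{a}| <o |A|"
        using inf by (intro finite_ordLess_infinite) (simp_all add: card_of_well_order_on Field_card_of)
      ultimately have "|B a| <o |A|"
        using card_of_Un_ordLess_infinite[OF inf, of "{a}"] by (simp add: B_def)
      then show ?thesis by (rule ordLeq_ordLess_trans[OF H(5)[OF False]])
    qed
    then have "\<exists>G. coordinates (H (B a)) G" if "a \<in> A" for a
      using that H(1,2)[OF BA[OF that]] less.prems(1) by (intro less.IH) (auto simp: B_def)
    then obtain G where G: "\<And>a. a \<in> A \<Longrightarrow> coordinates (H (B a)) (G a)" by metis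
    show ?thesis
    proof (rule coordinates_chain[OF less.prems(1) wf, of "\<lambda>a. H (B a)" G])
      show "(a, b) \<in> r \<or> (b, a) \<in> r" if "a \<in> A" "b \<in> A" "a \<noteq> b" for a b
        using tot that by (auto simp: r_def total_on_def)
      show "a \<in> A \<and> b \<in> A" if "(a, b) \<in> r" for a b using sub that by (auto simp: r_def)
      show "a \<in> H (B a) \<and> H (B a) \<subseteq> A \<and> directed_set le (H (B a))" if "a \<in> A" for a
        using H(1,2)[OF BA[OF that]] by (auto simp: B_def)
      show "H (B b) \<subseteq> H (B a)" if "(b, a) \<in> r" for a b
      proof (rule H(3))
        show "B b \<subseteq> B a"
          using that tr anti by (auto simp: B_def underS_def r_def dest: transD antisymD)
      qed
    qed (rule G)
  qed
qed

lemma sigma_family: "\<exists>F. sigma_family X F"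
proof -
  obtain F where F: "coordinates I F" using coordinates_exist[OF subset_refl directed] by auto
  have "(\<Union>s\<in>I. fixed_set s) \<subseteq> {x \<in> topspace X. countable {f \<in> F. f x \<noteq> 0}}"
    using F fixed_set_topspace by (auto simp: coordinates_def)
  from closure_of_mono[OF this, of X]
  have "X closure_of {x \<in> topspace X. countable {f \<in> F. f x \<noteq> 0}} = topspace X"
    unfolding fixed_set_dense by (simp add: closure_of_subset_topspace subset_antisym)
  moreover have "x = y" if "x \<in> topspace X" "y \<in> topspace X" "\<forall>f\<in>F. f x = f y" for x y
    using F that separating[OF that(1,2)] by (simp add: coordinates_def)
  ultimately have "sigma_family X F"
    using F by (simp add: sigma_family_def coordinates_def)
  then show ?thesis ..
qed

end

section \<open>From a commutative skeleton to commuting retractions\<close>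

text \<open>With \<open>R s\<close> the composite of \<open>p s\<close> and \<open>e s\<close>,
  absorption expresses the compatibility of projections with bonding maps and of embeddings with the
  right inverse. The image of \<open>R s\<close> is the copy of \<open>Y s\<close>.\<close>

lemma commutative_r_skeleton_retraction_system:
  assumes "compact_space X" "Hausdorff_space X"
    and skeleton: "commutative_r_skeleton X I le Y r p i"
  shows "\<exists>R. retraction_system X I le R"
proof -
  obtain e where e: "limit_embeddings X I le Y p i e"
    and commute: "\<forall>s\<in>I. \<forall>t\<in>I. \<forall>x\<in>topspace X. e s (p s (e t (p t x))) = e t (p t (e s (p s x)))"
    and sys: "inverse_system I le Y r" and complete: "sigma_complete I le Y r"
    and Y2: "\<forall>s\<in>I. second_countable (Y s)" and lim: "is_inverse_limit X p I le Y r"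
    and inv: "right_inverse I le Y r i"
    using skeleton unfolding commutative_r_skeleton_def r_skeleton_def by blast
  have po: "partial_order_on I le" and dir: "directed_set le I"
    using sys unfolding inverse_system_def by blast+
  have hom: "homeomorphic_map X (inverse_limit I le Y r) (\<lambda>x. \<lambda>s\<in>I. p s x)"
    using lim unfolding is_inverse_limit_def .
  have "continuous_map X (product_topology Y I) (\<lambda>x. \<lambda>s\<in>I. p s x)"
    using homeomorphic_imp_continuous_map[OF hom] unfolding inverse_limit_def
    by (simp add: continuous_map_in_subtopology)
  then have p: "continuous_map X (Y s) (p s)" if "s \<in> I" for s
    using that by (auto simp: continuous_map_componentwise)
  have p_in: "p s x \<in> topspace (Y s)" if "s \<in> I" "x \<in> topspace X" for s x
    using continuous_map_image_subset_topspace[OF p] that by blast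
  have rp: "r s t (p t x) = p s x" if "s \<in> I" "t \<in> I" "(s, t) \<in> le" "x \<in> topspace X" for s t x
  proof -
    have "(\<lambda>s\<in>I. p s x) \<in> topspace (inverse_limit I le Y r)"
      using homeomorphic_imp_surjective_map[OF hom] that(4) by blast
    then show ?thesis using that by (simp add: inverse_limit_def)
  qed
  have emb: "embedding_map (Y s) X (e s)" and pe: "\<And>y. y \<in> topspace (Y s) \<Longrightarrow> p s (e s y) = y"
    if "s \<in> I" for s
    using e that unfolding limit_embeddings_def by simp_all
  have e_cont: "continuous_map (Y s) X (e s)" if "s \<in> I" for s
    using emb[OF that] unfolding embedding_map_def
    using homeomorphic_imp_continuous_map continuous_map_in_subtopology by blast
  have e_in: "e s y \<in> topspace X" if "s \<in> I" "y \<in> topspace (Y s)" for s y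
    using continuous_map_image_subset_topspace[OF e_cont] that by blast
  have ei: "e t (i s t y) = e s y" if "(s, t) \<in> le" "y \<in> topspace (Y s)" for s t y
    using e that unfolding limit_embeddings_def by simp
  have i_in: "i s t y \<in> topspace (Y t)" if "(s, t) \<in> le" "y \<in> topspace (Y s)" for s t y
  proof -
    have "embedding_map (Y s) (Y t) (i s t)" using inv that(1) unfolding right_inverse_def by simp
    then have "continuous_map (Y s) (Y t) (i s t)"
      unfolding embedding_map_def
      using homeomorphic_imp_continuous_map continuous_map_in_subtopology by blast
    then show ?thesis using continuous_map_image_subset_topspace that(2) by blast
  qed
  let ?R = "\<lambda>s x. e s (p s x)"
  \<comment> \<open>\<open>p s\<close> undoes \<open>e s\<close>, so \<open>R s\<close> and
    \<open>p s\<close> identify the same points and statements pass between the two.\<close>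
  have p_eq: "p s x = p s y" if "s \<in> I" "x \<in> topspace X" "y \<in> topspace X" "?R s x = ?R s y" for s x y
  proof -
    have "p s (?R s x) = p s (?R s y)" using that(4) by simp
    then show ?thesis using pe[OF that(1)] p_in[OF that(1)] that(2,3) by simp
  qed
  have absorb: "?R s (?R t x) = ?R s x \<and> ?R t (?R s x) = ?R s x"
    if "s \<in> I" "t \<in> I" "(s, t) \<in> le" "x \<in> topspace X" for s t x
  proof
    have "p s (?R t x) = r s t (p t (?R t x))"
      using rp[OF that(1-3)] e_in p_in that by simp
    also have "\<dots> = p s x"
      using pe[OF that(2)] p_in[OF that(2)] rp that by simp
    finally show "?R s (?R t x) = ?R s x" by simp
    have y: "p s x \<in> topspace (Y s)" using p_in that by simp
    have "p t (?R s x) = i s t (p s x)"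
      using ei[OF that(3) y] pe[OF that(2) i_in[OF that(3) y]] by simp
    then show "?R t (?R s x) = ?R s x"
      using ei[OF that(3) y] by simp
  qed
  have "retraction_system X I le ?R"
  proof
    show "(s, s) \<in> le" if "s \<in> I" for s
      using partial_order_onD(1)[OF po] that by (simp add: refl_on_def)
    show "continuous_map X X (?R s)" if "s \<in> I" for s
      using continuous_map_compose[OF p[OF that] e_cont[OF that]] by (simp add: o_def)
    show "second_countable (subtopology X (?R s ` topspace X))" if s: "s \<in> I" for s
    proof -
      have "?R s ` topspace X = e s ` topspace (Y s)"
      proof
        show "e s ` topspace (Y s) \<subseteq> ?R s ` topspace X"
        proof
          fix z assume "z \<in> e s ` topspace (Y s)"
          then obtain y where y: "y \<in> topspace (Y s)" "z = e s y" by blast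
          then show "z \<in> ?R s ` topspace X"
            using pe[OF s y(1)] e_in[OF s y(1)] by (intro image_eqI[of _ _ z]) simp_all
        qed
      qed (use p_in[OF s] in auto)
      moreover have "Y s homeomorphic_space subtopology X (e s ` topspace (Y s))"
        by (rule embedding_map_imp_homeomorphic_space[OF emb[OF s]])
      ultimately show ?thesis
        using Y2 s homeomorphic_space_second_countability by metis
    qed
    show "x = y" if xy: "x \<in> topspace X" "y \<in> topspace X" and eq: "\<And>s. s \<in> I \<Longrightarrow> ?R s x = ?R s y" for x y
    proof (rule inj_onD[OF homeomorphic_imp_injective_map[OF hom] _ xy])
      show "(\<lambda>s\<in>I. p s x) = (\<lambda>s\<in>I. p s y)"
        using p_eq[OF _ xy eq] by (auto simp: restrict_def fun_eq_iff)
    qed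
    show "\<exists>u\<in>I. (\<forall>s\<in>D. (s, u) \<in> le) \<and>
        (\<forall>x\<in>topspace X. \<forall>y\<in>topspace X. (\<forall>s\<in>D. ?R s x = ?R s y) \<longrightarrow> ?R u x = ?R u y)"
      if D: "D \<subseteq> I" "countable D" "directed_set le D" for D
    proof -
      obtain u where u: "is_supremum I le D u" "is_inverse_limit (Y u) (\<lambda>s. r s u) D le Y r"
        using complete D unfolding sigma_complete_def by blast
      have uI: "u \<in> I" and le_u: "\<And>s. s \<in> D \<Longrightarrow> (s, u) \<in> le"
        using u(1) unfolding is_supremum_def by simp_all
      \<comment> \<open>As \<open>Y u\<close> is the limit over \<open>D\<close>, the components in
        \<open>D\<close> determine a point of \<open>Y u\<close>; this yields the determination of
        \<open>R u\<close> by the retractions in \<open>D\<close>.\<close>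
      have inj: "inj_on (\<lambda>x. \<lambda>s\<in>D. r s u x) (topspace (Y u))"
        using u(2) homeomorphic_imp_injective_map unfolding is_inverse_limit_def by blast
      have "?R u x = ?R u y" if xy: "x \<in> topspace X" "y \<in> topspace X"
        and eq: "\<forall>s\<in>D. ?R s x = ?R s y" for x y
      proof -
        have "r s u (p u x) = r s u (p u y)" if "s \<in> D" for s
        proof -
          have s: "s \<in> I" using that D(1) by blast
          show ?thesis
            using p_eq[OF s xy bspec[OF eq that]] rp[OF s uI le_u[OF that]] xy by simp
        qed
        then have "(\<lambda>s\<in>D. r s u (p u x)) = (\<lambda>s\<in>D. r s u (p u y))"
          by (auto simp: restrict_def fun_eq_iff)
        then have "p u x = p u y"
          using inj_onD[OF inj] p_in[OF uI] xy by blast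
        then show ?thesis by simp
      qed
      then show ?thesis using uI le_u by blast
    qed
  qed (use assms dir absorb commute in simp_all)
  then show ?thesis by blast
qed

lemma commutative_r_skeleton_imp_sigma_family:
  assumes "compact_space X" "Hausdorff_space X" "commutative_r_skeleton X I le Y r p i"
  shows "\<exists>F. sigma_family X F"
  using commutative_r_skeleton_retraction_system[OF assms] retraction_system.sigma_family by blast

(* The equivalence, together with the fact that fixing the types of the witnesses in
   valdivia_compact and has_commutative_r_skeleton is harmless: Valdivia embeddings with
   exponents of an arbitrary type 'k, and commutative r-skeletons with index set and
   spaces over arbitrary types 'i and 'b, are covered as well. *)
theorem theorem6p1:
  fixes X :: "'a topology"
  assumes "compact_space X" and "Hausdorff_space X"
  shows "(valdivia_compact X \<longleftrightarrow> has_commutative_r_skeleton X) \<and>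
    (\<forall>(T :: 'k set) h. valdivia_embedding X T h \<longrightarrow> valdivia_compact X) \<and>
    (\<forall>(I :: 'i set) le (Y :: 'i \<Rightarrow> 'b topology) r p i.
        commutative_r_skeleton X I le Y r p i \<longrightarrow> has_commutative_r_skeleton X)"
proof -
  have skeleton: "has_commutative_r_skeleton X" if "\<exists>F. sigma_family X F"
    using that sigma_space.has_commutative_r_skeleton[OF sigma_space.intro[OF assms]] by blast
  have valdivia: "valdivia_compact X" if "\<exists>F. sigma_family X F"
    using that sigma_family_imp_valdivia_compact[OF assms] by blast
  show ?thesis
  proof (intro conjI iffI allI impI)
    assume "valdivia_compact X"
    then obtain T :: "('a \<Rightarrow> real) set" and h where "valdivia_embedding X T h"
      unfolding valdivia_compact_def by blast
    then show "has_commutative_r_skeleton X"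
      by (intro skeleton valdivia_embedding_imp_sigma_family)
  next
    assume "has_commutative_r_skeleton X"
    then obtain I :: "('a \<Rightarrow> real) set set" and le and Y :: "('a \<Rightarrow> real) set \<Rightarrow> 'a topology" and r p i
      where "commutative_r_skeleton X I le Y r p i"
      unfolding has_commutative_r_skeleton_def by blast
    then show "valdivia_compact X"
      by (intro valdivia commutative_r_skeleton_imp_sigma_family[OF assms])
  next
    fix T :: "'k set" and h assume "valdivia_embedding X T h"
    then show "valdivia_compact X"
      by (intro valdivia valdivia_embedding_imp_sigma_family)
  next
    fix I :: "'i set" and le and Y :: "'i \<Rightarrow> 'b topology" and r p i
    assume "commutative_r_skeleton X I le Y r p i"
    then show "has_commutative_r_skeleton X"
      by (intro skeleton commutative_r_skeleton_imp_sigma_family[OF assms])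
  qed
qed

end
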